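(* Let $\mathcal{P}$ denote the set of primes and $\mathbb{N}$ the set of natural numbers. Let $$V=\left\{n:\ n=p+2^{m_1^2}+2^{m_2^2},\ p\in\mathcal{P},\ m_1,m_2\in\mathbb{N}\right\},$$ and for real $x$ let $V(x)=|V\cap[1,x]|$. Then there exist constants $c>0$ and $x_0$ such that $V(x)\geqslant c\,x$ for all $x\geqslant x_0$; that is, $V(x)\gg x$, so $V$ has positive lower density.
   Context: $\mathcal{P}$ is the set of all prime numbers and $\mathbb{N}$ the set of natural numbers. The notation $f(x)\gg g(x)$ means $f(x)\geqslant c\,g(x)$ for some absolute constant $c>0$ and all sufficiently large $x$. *)

theory Defs
  imports
    Complex_Main
    "HOL-Computational_Algebra.Primes"
    "HOL-Library.Extended_Real"
begin

text \<open>
  The exponents range over the positive integers. Admitting \<open>m\<^sub>1 = 0\<close> or \<open>m\<^sub>2 = 0\<close>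
  can only enlarge the set, so lower bounds for its counting function carry over.
\<close>

definition V :: "nat set" where
  "V = {n. \<exists>p m\<^sub>1 m\<^sub>2. prime p \<and> m\<^sub>1 \<ge> 1 \<and> m\<^sub>2 \<ge> 1 \<and>
          n = p + 2 ^ (m\<^sub>1\<^sup>2) + 2 ^ (m\<^sub>2\<^sup>2)}"

definition counting :: "nat set \<Rightarrow> real \<Rightarrow> nat" where
  "counting A x = card {n \<in> A. 1 \<le> real n \<and> real n \<le> x}"

definition lower_density :: "nat set \<Rightarrow> ereal" where
  "lower_density A = liminf (\<lambda>n. ereal (real (counting A (real n)) / real n))"

end

theory Submission
  imports
    Defs
    "HOL-Number_Theory.Number_Theory"
    "HOL-Computational_Algebra.Squarefree"
    "HOL-Analysis.Harmonic_Numbers"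
    "HOL-Real_Asymp.Real_Asymp"
begin

text \<open>
  Romanoff's method. Fix \<open>N\<close>, put \<open>M \<approx> sqrt (ln N)\<close>, and count representations
  \<open>n = p + 2^a\<^sup>2 + 2^b\<^sup>2\<close> with \<open>p < N\<close> and \<open>1 \<le> a < b \<le> M\<close>. Chebyshev's lower bound gives at least \<open>c N\<close>
  of them, so by Cauchy-Schwarz it suffices that the number of coincidences
  \<open>p + s = p' + s'\<close> is \<open>O(N)\<close> off the diagonal. For fixed \<open>h = s - s' > 0\<close>, Selberg's sieve bounds the
  number of \<open>p < N\<close> with \<open>p + h\<close> prime by a constant times \<open>N / ln\<^sup>2 N\<close> times
  \<open>(\<Prod>q | h. 1 + 1/q)\<^sup>2\<close>, and this product is at most a constant times
  \<open>1 + (\<Sum>q | h. q powr (-11/12))\<close>. It remains to bound the mean of the latter sum over the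
  \<open>O(M\<^sup>4)\<close> quadruples of exponents. If \<open>e\<close> is the order of \<open>2\<close> modulo an odd prime \<open>q\<close>, then
  \<open>q\<close> divides \<open>h\<close> only if the last exponent has a prescribed square modulo \<open>e\<close>, which for
  \<open>q \<le> M\<^sup>3\<close> happens with frequency \<open>O(d(e) e powr (-1/3))\<close>, where \<open>d(e)\<close> is the number of divisors.
  Since at most \<open>k\<close> primes, all congruent to \<open>1\<close> modulo \<open>k\<close>, belong to the order \<open>k\<close>, the sum
  over \<open>q\<close> converges.
\<close>

section \<open>Selberg's sieve\<close>

lemma sum_Pow_alternating:
  assumes "finite A"
  shows "(\<Sum>S\<in>Pow A. (-1::real) ^ card S) = (if A = {} then 1 else 0)"
proof -
  have "(\<Sum>S\<in>Pow A. (-1::real) ^ card S) = (\<Prod>x\<in>A. (-1) + 1)"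
    using prod_add[OF assms, of "\<lambda>_. -1::real" "\<lambda>_. 1"] by simp
  then show ?thesis using assms by (auto simp: card_gt_0_iff)
qed

text \<open>Moebius inversion on the lattice of subsets: removing \<open>L\<close> from every
  \<open>S\<close> turns the interval into all subsets of \<open>M - L\<close>, where the
  alternating sum cancels unless \<open>M - L\<close> is empty.\<close>

lemma sum_interval_alternating:
  assumes "finite M"
  shows "(\<Sum>S | L \<subseteq> S \<and> S \<subseteq> M. (-1::real) ^ card S) = (if L = M then (-1) ^ card M else 0)"
proof (cases "L \<subseteq> M")
  case True
  have fin: "finite L" using True assms finite_subset by blast
  have "(\<Sum>S | L \<subseteq> S \<and> S \<subseteq> M. (-1::real) ^ card S) = (\<Sum>S\<in>Pow (M - L). (-1) ^ card L * (-1) ^ card S)"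
  proof (rule sum.reindex_bij_witness[where i = "\<lambda>S. L \<union> S" and j = "\<lambda>S. S - L"])
    fix S assume "S \<in> {S. L \<subseteq> S \<and> S \<subseteq> M}"
    then have *: "L \<subseteq> S" "finite S" using assms finite_subset by auto
    then have "card S = card L + card (S - L)"
      by (simp add: card_Diff_subset card_mono fin)
    then show "(-1::real) ^ card L * (-1) ^ card (S - L) = (-1) ^ card S"
      by (simp add: power_add)
  qed (use True in auto)
  also have "\<dots> = (-1) ^ card L * (if M - L = {} then 1 else 0)"
    using sum_Pow_alternating[of "M - L"] assms by (simp add: sum_distrib_left[symmetric])
  finally show ?thesis using True by auto
qed (auto intro: sum.neutral)

text \<open>
  The weights \<open>l S\<close> are chosen such that the sum of \<open>l S * (\<Prod>p\<in>S. w p)\<close> over all \<open>S \<supseteq> L\<close> in \<open>D\<close>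
  is \<open>(-1) ^ card L * (\<Prod>p\<in>L. w p / (1 - w p)) / G\<close>; these sums diagonalise the quadratic form
  in the main term, whose value becomes \<open>1 / G\<close>.
\<close>

theorem selberg_sieve:
  fixes E :: "'p \<Rightarrow> 'n set" and w :: "'p \<Rightarrow> real"
  assumes finA: "finite A" and finP: "finite P"
    and D: "D \<subseteq> Pow P" "{} \<in> D" "\<And>S T. S \<in> D \<Longrightarrow> T \<subseteq> S \<Longrightarrow> T \<in> D"
    and w: "\<And>p. p \<in> P \<Longrightarrow> 0 < w p \<and> w p < 1"
    and R: "\<And>U. U \<subseteq> P \<Longrightarrow>
       \<bar>real (card {n\<in>A. \<forall>p\<in>U. n \<in> E p}) - X * (\<Prod>p\<in>U. w p)\<bar> \<le> R U"
  defines "G \<equiv> \<Sum>S\<in>D. \<Prod>p\<in>S. w p / (1 - w p)"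
  shows "real (card {n\<in>A. \<forall>p\<in>P. n \<notin> E p})
     \<le> X / G + (\<Sum>S\<in>D. \<Sum>T\<in>D. (\<Prod>p\<in>S. 1 / w p) * (\<Prod>p\<in>T. 1 / w p) * R (S \<union> T))"
proof -
  define g where "g = (\<lambda>S. \<Prod>p\<in>S. w p / (1 - w p))"
  define W where "W = (\<lambda>S. \<Prod>p\<in>S. w p)"
  define l where "l = (\<lambda>S. (-1) ^ card S / (W S * G) * (\<Sum>M | M \<in> D \<and> S \<subseteq> M. g M))"
  have finD: "finite D" using D(1) finP by (meson finite_Pow_iff finite_subset)
  have subP: "S \<subseteq> P" if "S \<in> D" for S using D(1) that by auto
  have finS: "finite S" if "S \<in> D" for S using subP[OF that] finP finite_subset by blast
  have gpos: "g S > 0" if "S \<in> D" for S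
    unfolding g_def using w subP[OF that] by (intro prod_pos) (auto simp: field_simps)
  have Wpos: "W S > 0" if "S \<subseteq> P" for S
    unfolding W_def using w that by (intro prod_pos) auto
  have Gdef: "G = (\<Sum>S\<in>D. g S)" by (simp add: G_def g_def)
  have Gpos: "G > 0" unfolding Gdef using D(2) finD gpos by (intro sum_pos) auto
  have l0: "l {} = 1" using Gpos by (simp add: l_def W_def Gdef)
  \<comment> \<open>A crude bound: the inner sum is a part of \<open>G\<close>. The resulting
    factors \<open>1 / w p\<close> enter the error term and cost only a power of the sieve
    level.\<close>
  have l_bound: "\<bar>l S\<bar> \<le> (\<Prod>p\<in>S. 1 / w p)" if "S \<in> D" for S
  proof -
    have le: "(\<Sum>M | M \<in> D \<and> S \<subseteq> M. g M) \<le> G" unfolding Gdef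
      using finD gpos by (intro sum_mono2) (auto intro: less_imp_le)
    have ge: "(\<Sum>M | M \<in> D \<and> S \<subseteq> M. g M) \<ge> 0"
      using gpos by (intro sum_nonneg) (auto intro: less_imp_le)
    have "\<bar>l S\<bar> = (\<Sum>M | M \<in> D \<and> S \<subseteq> M. g M) / (W S * G)"
      unfolding l_def using ge Wpos[OF subP[OF that]] Gpos
      by (simp add: abs_mult)
    also have "\<dots> \<le> G / (W S * G)"
      using le Wpos[OF subP[OF that]] Gpos by (intro divide_right_mono) auto
    also have "\<dots> = 1 / W S" using Gpos by simp
    finally show ?thesis by (simp add: W_def prod_dividef)
  qed
  \<comment> \<open>After exchanging the sums, each \<open>M\<close> carries an alternating sum over
    the sets between \<open>L\<close> and \<open>M\<close>, which vanishes unless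
    \<open>M = L\<close>.\<close>
  have diag: "(\<Sum>S | S \<in> D \<and> L \<subseteq> S. l S * W S) = (-1) ^ card L * g L / G" if "L \<in> D" for L
  proof -
    have "(\<Sum>S | S \<in> D \<and> L \<subseteq> S. l S * W S)
        = (\<Sum>S | S \<in> D \<and> L \<subseteq> S. \<Sum>M | M \<in> D \<and> S \<subseteq> M. (-1) ^ card S * g M / G)"
    proof (rule sum.cong[OF refl])
      fix S assume "S \<in> {S \<in> D. L \<subseteq> S}"
      then have "W S > 0" using Wpos subP by auto
      then show "l S * W S = (\<Sum>M | M \<in> D \<and> S \<subseteq> M. (-1) ^ card S * g M / G)"
        unfolding l_def sum_divide_distrib[symmetric] sum_distrib_left[symmetric] by simp
    qed
    also have "\<dots> = (\<Sum>M\<in>D. \<Sum>S | S \<in> D \<and> L \<subseteq> S \<and> S \<subseteq> M. (-1) ^ card S * g M / G)"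
      using sum.swap_restrict[of "{S\<in>D. L \<subseteq> S}" D "\<lambda>S M. (-1) ^ card S * g M / G" "\<lambda>S M. S \<subseteq> M"] finD
      by (simp add: conj_assoc)
    also have "\<dots> = (\<Sum>M\<in>D. if L = M then (-1) ^ card M * g M / G else 0)"
    proof (rule sum.cong[OF refl])
      fix M assume M: "M \<in> D"
      have "{S. S \<in> D \<and> L \<subseteq> S \<and> S \<subseteq> M} = {S. L \<subseteq> S \<and> S \<subseteq> M}" using D(3)[OF M] by auto
      then have "(\<Sum>S | S \<in> D \<and> L \<subseteq> S \<and> S \<subseteq> M. (-1) ^ card S * g M / G)
          = (\<Sum>S | L \<subseteq> S \<and> S \<subseteq> M. (-1) ^ card S) * (g M / G)"
        by (simp add: sum_distrib_right sum_divide_distrib)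
      then show "(\<Sum>S | S \<in> D \<and> L \<subseteq> S \<and> S \<subseteq> M. (-1) ^ card S * g M / G)
          = (if L = M then (-1) ^ card M * g M / G else 0)"
        using sum_interval_alternating[OF finS[OF M], of L] by simp
    qed
    also have "\<dots> = (-1) ^ card L * g L / G" using finD that by simp
    finally show ?thesis .
  qed
  \<comment> \<open>Separates \<open>S\<close> from \<open>T\<close>:
    \<open>W (S \<union> T) = W S * W T / W (S \<inter> T)\<close>, and the last denominator expands
    over subsets because \<open>1 / w p\<close> is \<open>1\<close> plus the reciprocal of
    \<open>w p / (1 - w p)\<close>.\<close>
  have Wun: "W (S \<union> T) = (\<Sum>L | L \<in> D \<and> L \<subseteq> S \<and> L \<subseteq> T. W S * W T / g L)" if "S \<in> D" "T \<in> D" for S T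
  proof -
    have fin: "finite (S \<inter> T)" using finS[OF that(1)] by simp
    have "W (S \<union> T) * W (S \<inter> T) = W S * W T"
      unfolding W_def using prod.union_inter[OF finS finS, OF that] .
    moreover have "1 / W (S \<inter> T) = (\<Sum>L\<in>Pow (S \<inter> T). 1 / g L)"
    proof -
      have "1 / W (S \<inter> T) = (\<Prod>p\<in>S \<inter> T. 1 / w p)" by (simp add: W_def prod_dividef)
      also have "\<dots> = (\<Prod>p\<in>S \<inter> T. 1 / (w p / (1 - w p)) + 1)"
        using w subP[OF that(1)] by (intro prod.cong refl) (force simp: field_simps)
      also have "\<dots> = (\<Sum>L\<in>Pow (S \<inter> T). 1 / g L)"
        unfolding prod_add[OF fin] by (simp add: g_def prod_dividef)
      finally show ?thesis .
    qed
    moreover have "W (S \<inter> T) > 0" using subP[OF that(1)] by (intro Wpos) auto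
    moreover have "W (S \<union> T) = W (S \<union> T) * W (S \<inter> T) * (1 / W (S \<inter> T))"
      using \<open>W (S \<inter> T) > 0\<close> by simp
    ultimately have "W (S \<union> T) = W S * W T * (\<Sum>L\<in>Pow (S \<inter> T). 1 / g L)"
      by metis
    moreover have "Pow (S \<inter> T) = {L. L \<in> D \<and> L \<subseteq> S \<and> L \<subseteq> T}" using D(3)[OF that(1)] by auto
    ultimately show ?thesis by (simp add: sum_distrib_left)
  qed
  have main: "(\<Sum>S\<in>D. \<Sum>T\<in>D. l S * l T * W (S \<union> T)) = 1 / G"
  proof -
    have "(\<Sum>S\<in>D. \<Sum>T\<in>D. l S * l T * W (S \<union> T))
      = (\<Sum>S\<in>D. \<Sum>T\<in>D. \<Sum>L\<in>D. if L \<subseteq> S \<and> L \<subseteq> T then (l S * W S) * (l T * W T) / g L else 0)"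
    proof (intro sum.cong refl)
      fix S T assume "S \<in> D" "T \<in> D"
      then have "l S * l T * W (S \<union> T) = (\<Sum>L | L \<in> D \<and> L \<subseteq> S \<and> L \<subseteq> T. (l S * W S) * (l T * W T) / g L)"
        using Wun by (simp add: sum_distrib_left mult_ac)
      also have "\<dots> = (\<Sum>L\<in>D. if L \<subseteq> S \<and> L \<subseteq> T then (l S * W S) * (l T * W T) / g L else 0)"
        using finD by (simp add: sum.inter_filter)
      finally show "l S * l T * W (S \<union> T)
        = (\<Sum>L\<in>D. if L \<subseteq> S \<and> L \<subseteq> T then (l S * W S) * (l T * W T) / g L else 0)" .
    qed
    also have "\<dots> = (\<Sum>S\<in>D. \<Sum>L\<in>D. \<Sum>T\<in>D. if L \<subseteq> S \<and> L \<subseteq> T then (l S * W S) * (l T * W T) / g L else 0)"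
      by (rule sum.cong[OF refl], rule sum.swap)
    also have "\<dots> = (\<Sum>L\<in>D. \<Sum>S\<in>D. \<Sum>T\<in>D. if L \<subseteq> S \<and> L \<subseteq> T then (l S * W S) * (l T * W T) / g L else 0)"
      by (rule sum.swap)
    also have "\<dots> = (\<Sum>L\<in>D. (\<Sum>S\<in>D. if L \<subseteq> S then l S * W S else 0)\<^sup>2 / g L)"
      unfolding power2_eq_square sum_product sum_divide_distrib
      by (intro sum.cong refl) auto
    also have "\<dots> = (\<Sum>L\<in>D. (\<Sum>S | S \<in> D \<and> L \<subseteq> S. l S * W S)\<^sup>2 / g L)"
      using finD by (simp add: sum.inter_filter)
    also have "\<dots> = (\<Sum>L\<in>D. g L / G\<^sup>2)"
    proof (rule sum.cong[OF refl])
      fix L assume L: "L \<in> D"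
      have "((-1::real) ^ card L)\<^sup>2 = 1" by (simp add: power_mult[symmetric])
      then show "(\<Sum>S | S \<in> D \<and> L \<subseteq> S. l S * W S)\<^sup>2 / g L = g L / G\<^sup>2"
        using diag[OF L] gpos[OF L] by (simp add: power_divide power_mult_distrib power2_eq_square)
    qed
    also have "\<dots> = 1 / G" using Gpos by (simp add: sum_divide_distrib[symmetric] Gdef[symmetric] power2_eq_square)
    finally show ?thesis .
  qed
  \<comment> \<open>Selberg's majorant: \<open>(c n)\<^sup>2\<close> is never negative, and it is
    \<open>1\<close> at an unsifted \<open>n\<close>, where only \<open>S = {}\<close> contributes
    and \<open>l {} = 1\<close>.\<close>
  define c where "c = (\<lambda>n. \<Sum>S | S \<in> D \<and> (\<forall>p\<in>S. n \<in> E p). l S)"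
  have "real (card {n\<in>A. \<forall>p\<in>P. n \<notin> E p}) = (\<Sum>n | n \<in> A \<and> (\<forall>p\<in>P. n \<notin> E p). 1)" by simp
  also have "\<dots> \<le> (\<Sum>n | n \<in> A \<and> (\<forall>p\<in>P. n \<notin> E p). (c n)\<^sup>2)"
  proof (rule sum_mono)
    fix n assume n: "n \<in> {n\<in>A. \<forall>p\<in>P. n \<notin> E p}"
    have "{S. S \<in> D \<and> (\<forall>p\<in>S. n \<in> E p)} = {{}}"
    proof -
      have "S = {}" if "S \<in> D" "\<forall>p\<in>S. n \<in> E p" for S using that subP[OF that(1)] n by auto
      then show ?thesis using D(2) by auto
    qed
    then show "1 \<le> (c n)\<^sup>2" by (simp add: c_def l0)
  qed
  also have "\<dots> \<le> (\<Sum>n\<in>A. (c n)\<^sup>2)" using finA by (intro sum_mono2) auto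
  also have "\<dots> = (\<Sum>n\<in>A. \<Sum>S\<in>D. \<Sum>T\<in>D. if \<forall>p\<in>S \<union> T. n \<in> E p then l S * l T else 0)"
  proof (rule sum.cong[OF refl])
    fix n
    have "c n = (\<Sum>S\<in>D. if \<forall>p\<in>S. n \<in> E p then l S else 0)" using finD by (simp add: c_def sum.inter_filter)
    then have "(c n)\<^sup>2 = (\<Sum>S\<in>D. \<Sum>T\<in>D. (if \<forall>p\<in>S. n \<in> E p then l S else 0) * (if \<forall>p\<in>T. n \<in> E p then l T else 0))"
      by (simp add: power2_eq_square sum_product)
    also have "\<dots> = (\<Sum>S\<in>D. \<Sum>T\<in>D. if \<forall>p\<in>S \<union> T. n \<in> E p then l S * l T else 0)"
      by (intro sum.cong refl) auto
    finally show "(c n)\<^sup>2 = \<dots>" .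
  qed
  also have "\<dots> = (\<Sum>S\<in>D. \<Sum>T\<in>D. \<Sum>n\<in>A. if \<forall>p\<in>S \<union> T. n \<in> E p then l S * l T else 0)"
    by (subst sum.swap, rule sum.cong[OF refl], rule sum.swap)
  also have "\<dots> = (\<Sum>S\<in>D. \<Sum>T\<in>D. l S * l T * real (card {n\<in>A. \<forall>p\<in>S \<union> T. n \<in> E p}))"
    using finA by (simp add: sum.inter_filter[symmetric] mult.commute)
  also have "\<dots> \<le> (\<Sum>S\<in>D. \<Sum>T\<in>D. X * (l S * l T * W (S \<union> T))
      + (\<Prod>p\<in>S. 1 / w p) * (\<Prod>p\<in>T. 1 / w p) * R (S \<union> T))"
  proof (intro sum_mono)
    fix S T assume ST: "S \<in> D" "T \<in> D"
    define a where "a = real (card {n\<in>A. \<forall>p\<in>S \<union> T. n \<in> E p})"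
    have r: "\<bar>a - X * W (S \<union> T)\<bar> \<le> R (S \<union> T)"
      unfolding a_def W_def using subP[OF ST(1)] subP[OF ST(2)] by (intro R) auto
    have "l S * l T * (a - X * W (S \<union> T)) \<le> \<bar>l S\<bar> * \<bar>l T\<bar> * \<bar>a - X * W (S \<union> T)\<bar>"
      by (metis abs_ge_self abs_mult)
    also have "\<dots> \<le> (\<Prod>p\<in>S. 1 / w p) * (\<Prod>p\<in>T. 1 / w p) * R (S \<union> T)"
      using l_bound[OF ST(1)] l_bound[OF ST(2)] r
      by (intro mult_mono mult_nonneg_nonneg) (auto intro: order_trans[OF abs_ge_zero])
    finally show "l S * l T * a \<le> X * (l S * l T * W (S \<union> T))
      + (\<Prod>p\<in>S. 1 / w p) * (\<Prod>p\<in>T. 1 / w p) * R (S \<union> T)" by (simp add: algebra_simps)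
  qed
  also have "\<dots> = X / G + (\<Sum>S\<in>D. \<Sum>T\<in>D. (\<Prod>p\<in>S. 1 / w p) * (\<Prod>p\<in>T. 1 / w p) * R (S \<union> T))"
    using main by (simp add: sum.distrib sum_distrib_left[symmetric])
  finally show ?thesis .
qed

section \<open>Upper bound for prime pairs\<close>

lemma card_periodic:
  fixes Q :: "nat \<Rightarrow> bool"
  assumes "\<And>n. Q (n mod m) \<longleftrightarrow> Q n" "m > 0"
  shows "card {n. n < q * m + s \<and> Q n} = q * card {r. r < m \<and> Q r} + card {r. r < s \<and> Q r}"
proof (induction q)
  case (Suc q)
  have shift: "Q (n + m) \<longleftrightarrow> Q n" for n using assms(1)[of "n + m"] assms(1)[of n] by simp
  have "{n. n < Suc q * m + s \<and> Q n} = {r. r < m \<and> Q r} \<union> (\<lambda>n. n + m) ` {n. n < q * m + s \<and> Q n}"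
    (is "?A = ?B \<union> ?f ` ?C")
  proof (intro equalityI subsetI)
    fix n assume n: "n \<in> ?A"
    show "n \<in> ?B \<union> ?f ` ?C"
    proof (cases "n < m")
      case False
      then have "n = ?f (n - m)" "n - m \<in> ?C" using n shift[of "n - m"] by auto
      then show ?thesis by blast
    qed (use n in auto)
  qed (use shift in auto)
  moreover have "?B \<inter> ?f ` ?C = {}" by auto
  moreover have "card (?f ` ?C) = card ?C" by (intro card_image) (auto simp: inj_on_def)
  ultimately show ?case using Suc by (simp add: card_Un_disjoint)
qed simp

text \<open>Complete periods contribute exactly. The last incomplete one and its expected share both
  lie between \<open>0\<close> and \<open>c\<close>, hence differ by at most
  \<open>c\<close>.\<close>

lemma card_periodic_approx:
  fixes Q :: "nat \<Rightarrow> bool"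
  assumes "\<And>n. Q (n mod m) \<longleftrightarrow> Q n" "m > 0"
  defines "c \<equiv> real (card {r. r < m \<and> Q r})"
  shows "\<bar>real (card {n. n < N \<and> Q n}) - real N * (c / real m)\<bar> \<le> c"
proof -
  define s where "s = N mod m"
  define d where "d = real (card {r. r < s \<and> Q r})"
  have "s < m" using assms(2) by (simp add: s_def)
  have N: "N = N div m * m + s" by (simp add: s_def)
  have d: "0 \<le> d" "d \<le> c" unfolding d_def c_def using \<open>s < m\<close> by (auto intro!: card_mono)
  have "card {n. n < N \<and> Q n} = N div m * card {r. r < m \<and> Q r} + card {r. r < s \<and> Q r}"
    using card_periodic[of Q m, OF assms(1,2), of "N div m" s] N by simp
  then have "real (card {n. n < N \<and> Q n}) = real (N div m) * c + d" by (simp add: c_def d_def)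
  moreover have "real N * (c / real m) = real (N div m) * c + real s / real m * c"
  proof -
    have "real N = real (N div m) * real m + real s" using N by (metis of_nat_add of_nat_mult)
    then show ?thesis using assms(2) by (simp add: field_simps)
  qed
  moreover have "real s / real m \<le> 1" using \<open>s < m\<close> by simp
  then have "0 \<le> real s / real m * c" "real s / real m * c \<le> 1 * c"
    using d mult_right_mono[of "real s / real m" 1 c] by simp_all
  ultimately show ?thesis using d by linarith
qed

text \<open>The Chinese remainder theorem: \<open>r\<close> corresponds to its pair of residues, on
  which the two conditions are independent.\<close>

lemma card_coprime_mult:
  fixes a b :: nat
  assumes "coprime a b" "a > 0" "b > 0"
  shows "card {r. r < a * b \<and> P (r mod a) \<and> Q (r mod b)} = card {r. r < a \<and> P r} * card {r. r < b \<and> Q r}"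
proof -
  have "bij_betw (\<lambda>r. (r mod a, r mod b)) {r. r < a * b \<and> P (r mod a) \<and> Q (r mod b)}
     ({r. r < a \<and> P r} \<times> {r. r < b \<and> Q r})"
    unfolding bij_betw_def
  proof (intro conjI equalityI subsetI inj_onI)
    fix x y assume "x \<in> {r. r < a * b \<and> P (r mod a) \<and> Q (r mod b)}"
      "y \<in> {r. r < a * b \<and> P (r mod a) \<and> Q (r mod b)}" "(x mod a, x mod b) = (y mod a, y mod b)"
    then have "[x = y] (mod a * b)" "x < a * b" "y < a * b"
      using assms coprime_cong_mult_nat[of x y a b] by (auto simp: unique_euclidean_semiring_class.cong_def)
    then show "x = y" by (simp add: unique_euclidean_semiring_class.cong_def)
  next
    fix z assume z: "z \<in> {r. r < a \<and> P r} \<times> {r. r < b \<and> Q r}"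
    obtain x where "x < a * b" "[x = fst z] (mod a)" "[x = snd z] (mod b)"
      using binary_chinese_remainder_unique_nat[of a b "fst z" "snd z"] assms by auto
    then show "z \<in> (\<lambda>r. (r mod a, r mod b)) ` {r. r < a * b \<and> P (r mod a) \<and> Q (r mod b)}"
      using z by (auto simp: unique_euclidean_semiring_class.cong_def image_iff intro!: exI[of _ x])
  qed (use assms in auto)
  then show ?thesis by (simp add: bij_betw_same_card card_cartesian_product)
qed

lemma dvd_shifted_square_mod:
  fixes p m r h :: nat
  assumes "p dvd m"
  shows "p dvd (r mod m) * (r mod m + h) \<longleftrightarrow> p dvd r * (r + h)"
proof -
  have "[r mod m = r] (mod p)" using assms by (simp add: unique_euclidean_semiring_class.cong_def mod_mod_cancel)
  then have "[(r mod m) * (r mod m + h) = r * (r + h)] (mod p)" by (intro cong_mult cong_add cong_refl)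
  then show ?thesis by (rule cong_dvd_iff)
qed

text \<open>The roots modulo \<open>p\<close> are the classes of \<open>0\<close> and
  \<open>- h\<close>, distinct because \<open>p\<close> does not divide \<open>h\<close>.\<close>

lemma card_roots_prime:
  fixes p h :: nat
  assumes "prime p" "\<not> p dvd h"
  shows "card {r. r < p \<and> p dvd r * (r + h)} = 2"
proof -
  have pos: "h mod p > 0" "h mod p < p" "p > 0" using assms prime_gt_0_nat by (auto simp: mod_greater_zero_iff_not_dvd)
  have "{r. r < p \<and> p dvd r * (r + h)} = {0, p - h mod p}"
  proof (intro equalityI subsetI)
    fix r assume r: "r \<in> {r. r < p \<and> p dvd r * (r + h)}"
    then consider "p dvd r" | "p dvd r + h" using assms(1) prime_dvd_mult_iff by auto
    then show "r \<in> {0, p - h mod p}"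
    proof cases
      case 1
      then show ?thesis using r by (auto dest: dvd_imp_le)
    next
      case 2
      then have "p dvd r + h mod p" by (metis mod_add_right_eq mod_eq_0_iff_dvd)
      then obtain k where k: "r + h mod p = p * k" by blast
      have "k < 2" using r pos k by (metis (no_types, lifting) add_less_mono mem_Collect_eq mult_2_right nat_mult_less_cancel1)
      moreover have "k \<noteq> 0" using k pos by (cases k) auto
      ultimately have "k = 1" by simp
      then have "r = p - h mod p" using k by (metis add_diff_cancel_right' mult.right_neutral)
      then show ?thesis by simp
    qed
  next
    fix r assume "r \<in> {0, p - h mod p}"
    moreover have "p dvd (p - h mod p) + h"
    proof -
      have "(p - h mod p) + h = p + h div p * p" using pos by (metis add.assoc add.commute div_mult_mod_eq le_add_diff_inverse less_imp_le)
      then show ?thesis by simp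
    qed
    ultimately show "r \<in> {r. r < p \<and> p dvd r * (r + h)}" using pos by auto
  qed
  moreover have "p - h mod p \<noteq> 0" using pos by linarith
  ultimately show ?thesis by simp
qed

lemma card_roots_squarefree:
  fixes U :: "nat set"
  assumes "finite U" "\<And>p. p \<in> U \<Longrightarrow> prime p \<and> \<not> p dvd h"
  shows "card {r. r < \<Prod>U \<and> (\<forall>p\<in>U. p dvd r * (r + h))} = 2 ^ card U"
  using assms
proof (induction U rule: finite_induct)
  case empty
  have "{r::nat. r < 1} = {0}" by auto
  then show ?case by simp
next
  case (insert p F)
  define m where "m = \<Prod>F"
  have "m > 0" unfolding m_def using insert by (intro prod_pos) (auto simp: prime_gt_0_nat)
  have cop: "coprime p m" unfolding m_def
    using insert by (intro prod_coprime_right) (metis insertCI primes_coprime)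
  have "{r. r < \<Prod>(insert p F) \<and> (\<forall>q\<in>insert p F. q dvd r * (r + h))}
     = {r. r < p * m \<and> p dvd (r mod p) * (r mod p + h) \<and> (\<forall>q\<in>F. q dvd (r mod m) * (r mod m + h))}"
  proof -
    have "q dvd m" if "q \<in> F" for q unfolding m_def using insert that by (intro dvd_prodI) auto
    then show ?thesis using insert by (auto simp: dvd_shifted_square_mod m_def)
  qed
  also have "card \<dots> = 2 * 2 ^ card F"
    using card_coprime_mult[OF cop, of "\<lambda>r. p dvd r * (r + h)" "\<lambda>r. \<forall>q\<in>F. q dvd r * (r + h)"]
      card_roots_prime[of p h] insert \<open>m > 0\<close> by (simp add: m_def prime_gt_0_nat)
  finally show ?case using insert by simp
qed

text \<open>The input that the sieve requires: local density \<open>2 / p\<close>, with an error of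
  at most one period, that is, the number \<open>2 ^ card U\<close> of roots modulo the
  product.\<close>

lemma card_divisible_approx:
  fixes U :: "nat set"
  assumes "finite U" "\<And>p. p \<in> U \<Longrightarrow> prime p \<and> \<not> p dvd h"
  shows "\<bar>real (card {n. n < N \<and> (\<forall>p\<in>U. p dvd n * (n + h))}) - real N * (\<Prod>p\<in>U. 2 / real p)\<bar> \<le> 2 ^ card U"
proof -
  have pos: "\<Prod>U > 0" using assms by (intro prod_pos) (auto simp: prime_gt_0_nat)
  have "q dvd \<Prod>U" if "q \<in> U" for q using assms that by (intro dvd_prodI) auto
  then have per: "(\<forall>p\<in>U. p dvd n mod \<Prod>U * (n mod \<Prod>U + h)) \<longleftrightarrow> (\<forall>p\<in>U. p dvd n * (n + h))" for n
    by (simp add: dvd_shifted_square_mod)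
  have "(\<Prod>p\<in>U. 2 / real p) = 2 ^ card U / real (\<Prod>U)" by (simp add: prod_dividef)
  then show ?thesis
    using card_periodic_approx[of "\<lambda>n. \<forall>p\<in>U. p dvd n * (n + h)", OF per pos, of N]
    by (simp add: card_roots_squarefree[OF assms])
qed

section \<open>Lower bound for the sieve denominator\<close>

lemma sum_inverse_squares_le: "(\<Sum>k=1..n. 1 / (real k)\<^sup>2) \<le> 2"
proof -
  have "(\<Sum>k=1..n. 1 / (real k)\<^sup>2) \<le> 2 - 1 / real n" if "n > 0" for n
    using that
  proof (induction n rule: nat_induct_non_zero)
    case (Suc n)
    have "1 / (real (Suc n))\<^sup>2 \<le> 1 / (real n * real (Suc n))"
      using Suc.hyps by (intro divide_left_mono) (auto simp: power2_eq_square)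
    also have "\<dots> = 1 / real n - 1 / real (Suc n)" using Suc.hyps by (simp add: field_simps)
    finally have "1 / (real (Suc n))\<^sup>2 \<le> 1 / real n - 1 / real (Suc n)" .
    then show ?case using Suc by simp
  qed simp
  from this[of n] show ?thesis by (cases "n = 0") (auto intro: order_trans)
qed

lemma prime_factors_prod_primes:
  fixes S :: "nat set"
  assumes "finite S" "\<And>p. p \<in> S \<Longrightarrow> prime p"
  shows "prime_factors (\<Prod>S) = S"
proof -
  have "0 \<notin> (\<lambda>p. p) ` S"
  proof
    assume "0 \<in> (\<lambda>p. p) ` S"
    then have "0 \<in> S" by simp
    from assms(2)[OF this] show False by simp
  qed
  with assms(1) have "prime_factors (\<Prod>S) = \<Union>((prime_factors \<circ> (\<lambda>p. p)) ` S)"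
    by (rule prime_factors_prod)
  also have "\<dots> = (\<Union>p\<in>S. {p})"
    unfolding comp_def by (intro SUP_cong refl prime_prime_factors assms(2))
  finally show ?thesis by simp
qed

text \<open>By unique factorisation a set of primes is determined by its product, a number in
  \<open>{1..z}\<close>.\<close>

lemma card_prime_subsets_le:
  assumes "finite P" "\<And>p. p \<in> P \<Longrightarrow> prime (p::nat)"
  shows "card {S. S \<subseteq> P \<and> \<Prod>S \<le> z} \<le> z"
proof -
  have fin: "finite S" if "S \<subseteq> P" for S using that assms(1) finite_subset by blast
  have "inj_on \<Prod> {S. S \<subseteq> P \<and> \<Prod>S \<le> z}"
    by (rule inj_onI) (metis (no_types, lifting) assms(2) fin mem_Collect_eq prime_factors_prod_primes subset_iff)
  moreover have "\<Prod> ` {S. S \<subseteq> P \<and> \<Prod>S \<le> z} \<subseteq> {1..z}"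
  proof clarify
    fix S assume "S \<subseteq> P" "\<Prod>S \<le> z"
    moreover have "\<Prod>S > 0" using assms(2) \<open>S \<subseteq> P\<close> by (intro prod_pos) (meson prime_gt_0_nat subset_iff)
    ultimately show "\<Prod>S \<in> {1..z}" by simp
  qed
  ultimately show ?thesis using card_inj_on_le[of \<Prod> _ "{1..z}"] by simp
qed

text \<open>Every \<open>n \<le> N\<close> is the product of a squarefree number and a square, and \<open>\<Sum>k. 1/k\<^sup>2 \<le> 2\<close>.\<close>

lemma harm_le_sum_squarefree:
  fixes Pr :: "nat set"
  assumes "finite Pr" "\<And>p. prime p \<Longrightarrow> p \<le> N \<Longrightarrow> p \<in> Pr"
  shows "harm N \<le> 2 * (\<Sum>S | S \<subseteq> Pr \<and> \<Prod>S \<le> N. \<Prod>p\<in>S. 1 / real p)"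
proof -
  define D where "D = {S. S \<subseteq> Pr \<and> \<Prod>S \<le> N}"
  define j where "j = (\<lambda>n::nat. (prime_factors (squarefree_part n), square_part n))"
  define f where "f = (\<lambda>(S :: nat set, k :: nat). (\<Prod>p\<in>S. 1 / real p) * (1 / (real k)\<^sup>2))"
  have finD: "finite D" unfolding D_def using assms(1) by auto
  have prod: "\<Prod>(prime_factors (squarefree_part n)) = squarefree_part n" for n :: nat
  proof -
    have "squarefree_part n = (\<Prod>p\<in>prime_factors (squarefree_part n). p ^ multiplicity p (squarefree_part n))"
      by (rule prime_factorization_nat) (auto intro: Nat.gr0I)
    also have "\<dots> = \<Prod>(prime_factors (squarefree_part n))"
    proof (rule prod.cong[OF refl])
      fix p assume p: "p \<in> prime_factors (squarefree_part n)"
      then have "multiplicity p (squarefree_part n) \<noteq> 0" by (auto simp: prime_factors_multiplicity)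
      moreover have "multiplicity p (squarefree_part n) \<le> Suc 0"
        using p by (intro prime_multiplicity_squarefree_part_le_Suc_0) auto
      ultimately have "multiplicity p (squarefree_part n) = 1" by simp
      then show "p ^ multiplicity p (squarefree_part n) = p" by simp
    qed
    finally show ?thesis by simp
  qed
  \<comment> \<open>The squarefree part is recovered from its prime factors, and \<open>n\<close>
    from its squarefree and square parts.\<close>
  have inj: "inj_on j {1..N}"
  proof (rule inj_onI)
    fix m n assume "j m = j n"
    then have "prime_factors (squarefree_part m) = prime_factors (squarefree_part n)"
      and *: "square_part m = square_part n"
      unfolding j_def prod.inject by blast+
    then have "squarefree_part m = squarefree_part n" using prod by metis
    with * show "m = n" by (metis squarefree_decompose)
  qed
  have sub: "j ` {1..N} \<subseteq> D \<times> {1..N}"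
  proof (rule image_subsetI)
    fix n assume n: "n \<in> {1..N}"
    have nz: "squarefree_part n > 0" "square_part n > 0" using n by (auto intro!: Nat.gr0I)
    have "squarefree_part n dvd n" using squarefree_decompose by (rule dvdI)
    then have le: "squarefree_part n \<le> n" using n by (intro dvd_imp_le) auto
    have "square_part n dvd n" using dvd_trans[OF dvd_power square_part_square_dvd] by simp
    then have le': "square_part n \<le> n" using n by (intro dvd_imp_le) auto
    have "prime_factors (squarefree_part n) \<subseteq> Pr"
    proof
      fix p assume "p \<in> prime_factors (squarefree_part n)"
      then have "prime p" "p dvd squarefree_part n" by auto
      then have "p \<le> N" using dvd_imp_le[of p "squarefree_part n"] nz le n by auto
      then show "p \<in> Pr" using assms(2) \<open>prime p\<close> by blast
    qed
    then show "j n \<in> D \<times> {1..N}" using n nz le le' prod[of n] by (auto simp: D_def j_def)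
  qed
  have "harm N = (\<Sum>n=1..N. f (j n))" unfolding harm_def
  proof (rule sum.cong[OF refl])
    fix n :: nat
    have "(\<Prod>p\<in>prime_factors (squarefree_part n). 1 / real p) = 1 / real (\<Prod>(prime_factors (squarefree_part n)))"
      by (simp add: prod_dividef)
    then have "f (j n) = 1 / real (squarefree_part n * (square_part n)\<^sup>2)"
      by (simp add: f_def j_def prod)
    then show "inverse (real n) = f (j n)"
      unfolding squarefree_decompose[symmetric] by (simp add: inverse_eq_divide)
  qed
  also have "\<dots> = (\<Sum>x\<in>j ` {1..N}. f x)" using inj by (simp add: sum.reindex)
  also have "\<dots> \<le> (\<Sum>x\<in>D \<times> {1..N}. f x)"
    using sub finD by (intro sum_mono2) (auto simp: f_def intro!: divide_nonneg_nonneg prod_nonneg)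
  also have "\<dots> = (\<Sum>S\<in>D. \<Prod>p\<in>S. 1 / real p) * (\<Sum>k=1..N. 1 / (real k)\<^sup>2)"
    unfolding f_def sum_product sum.cartesian_product by simp
  also have "\<dots> \<le> (\<Sum>S\<in>D. \<Prod>p\<in>S. 1 / real p) * 2"
    by (intro mult_left_mono sum_inverse_squares_le sum_nonneg prod_nonneg) auto
  finally show ?thesis by (simp add: D_def)
qed

text \<open>Split \<open>S\<close> into \<open>S \<inter> P\<close> and \<open>S - P\<close>. The
  first part keeps the bound on the product, being a divisor; forgetting the bound on the second
  part yields a finite Euler product.\<close>

lemma sum_prime_subsets_split:
  fixes Pr P :: "nat set"
  assumes "finite Pr" "P \<subseteq> Pr" "\<And>p. p \<in> Pr \<Longrightarrow> p > 0"
  shows "(\<Sum>S | S \<subseteq> Pr \<and> \<Prod>S \<le> N. \<Prod>p\<in>S. 1 / real p)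
     \<le> (\<Sum>S | S \<subseteq> P \<and> \<Prod>S \<le> N. \<Prod>p\<in>S. 1 / real p) * (\<Prod>q\<in>Pr - P. 1 + 1 / real q)"
proof -
  define j where "j = (\<lambda>S. (S \<inter> P, S - P))"
  define f where "f = (\<lambda>(S, T). (\<Prod>p\<in>S. 1 / real p) * (\<Prod>p\<in>T. 1 / real p))"
  let ?D = "\<lambda>A. {S. S \<subseteq> A \<and> \<Prod>S \<le> N}"
  have fin: "finite S" if "S \<subseteq> Pr" for S using that assms(1) finite_subset by blast
  have inj: "inj_on j (?D Pr)" by (rule inj_onI) (auto simp: j_def)
  have sub: "j ` ?D Pr \<subseteq> ?D P \<times> Pow (Pr - P)"
  proof (rule image_subsetI)
    fix S assume "S \<in> ?D Pr"
    then have S: "S \<subseteq> Pr" "\<Prod>S \<le> N" by auto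
    have "\<Prod>(S \<inter> P) dvd \<Prod>S" using fin[OF S(1)] by (intro prod_dvd_prod_subset) auto
    moreover have "\<Prod>S > 0" using S assms(3) by (intro prod_pos) auto
    ultimately have "\<Prod>(S \<inter> P) \<le> \<Prod>S" by (rule dvd_imp_le)
    then show "j S \<in> ?D P \<times> Pow (Pr - P)" using S by (auto simp: j_def)
  qed
  have finD: "finite (?D P)" using assms(1,2) by (auto intro!: finite_subset[of _ "Pow Pr"])
  have "(\<Sum>S\<in>?D Pr. \<Prod>p\<in>S. 1 / real p) = (\<Sum>S\<in>?D Pr. f (j S))"
  proof (rule sum.cong[OF refl])
    fix S assume "S \<in> ?D Pr"
    then have "finite S" using fin by auto
    then have "prod g S = prod g (S \<inter> P) * prod g (S - P)" for g :: "nat \<Rightarrow> real"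
      by (metis prod.Int_Diff)
    then show "(\<Prod>p\<in>S. 1 / real p) = f (j S)" by (simp add: f_def j_def)
  qed
  also have "\<dots> = (\<Sum>x\<in>j ` ?D Pr. f x)" using inj by (simp add: sum.reindex)
  also have "\<dots> \<le> (\<Sum>x\<in>?D P \<times> Pow (Pr - P). f x)"
    using sub finD assms(1) by (intro sum_mono2) (auto simp: f_def intro!: mult_nonneg_nonneg prod_nonneg)
  also have "\<dots> = (\<Sum>S\<in>?D P. \<Prod>p\<in>S. 1 / real p) * (\<Sum>T\<in>Pow (Pr - P). \<Prod>p\<in>T. 1 / real p)"
    unfolding f_def sum_product sum.cartesian_product by simp
  also have "(\<Sum>T\<in>Pow (Pr - P). \<Prod>p\<in>T. 1 / real p) = (\<Prod>q\<in>Pr - P. 1 / real q + 1)"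
    using assms(1) by (subst prod_add) auto
  finally show ?thesis by (simp add: add.commute)
qed

text \<open>
  A pair \<open>(S, T)\<close> is encoded by \<open>U = S \<union> T\<close>, \<open>S\<close> and \<open>R = S \<inter> T\<close>; summing over \<open>R \<subseteq> S \<subseteq> U\<close>
  gives \<open>\<Prod>p\<in>U. 2 / p + 1 / p\<^sup>2\<close>.
\<close>

lemma sum_prime_subsets_square:
  fixes P :: "nat set"
  assumes "finite P" "\<And>p. p \<in> P \<Longrightarrow> p \<ge> 3"
  shows "(\<Sum>S | S \<subseteq> P \<and> \<Prod>S \<le> w. \<Prod>p\<in>S. 1 / real p)\<^sup>2
    \<le> (\<Sum>U | U \<subseteq> P \<and> \<Prod>U \<le> w\<^sup>2. \<Prod>p\<in>U. (2 / real p) / (1 - 2 / real p))"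
proof -
  define D where "D = {S. S \<subseteq> P \<and> \<Prod>S \<le> w}"
  define D' where "D' = {S. S \<subseteq> P \<and> \<Prod>S \<le> w\<^sup>2}"
  define a where "a = (\<lambda>S. \<Prod>p\<in>S. 1 / real p)"
  define j :: "nat set \<times> nat set \<Rightarrow> nat set \<times> nat set \<times> nat set"
    where "j = (\<lambda>(S, T). (S \<union> T, S, S \<inter> T))"
  define f :: "nat set \<times> nat set \<times> nat set \<Rightarrow> real" where "f = (\<lambda>(U, S, R). a U * a R)"
  define B where "B = (SIGMA U:D'. SIGMA S:Pow U. Pow S)"
  have fin: "finite S" if "S \<subseteq> P" for S using that assms(1) finite_subset by blast
  have finD: "finite D" "finite D'" using assms(1) by (auto simp: D_def D'_def)
  have finB: "finite B" unfolding B_def using finD fin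
    by (intro finite_SigmaI) (auto simp: D'_def intro: finite_subset)
  have a0: "a S \<ge> 0" for S by (auto simp: a_def intro!: prod_nonneg)
  have inj: "inj_on j (D \<times> D)" by (rule inj_onI) (auto simp: j_def)
  have sub: "j ` (D \<times> D) \<subseteq> B"
  proof (rule image_subsetI, clarify)
    fix S T assume ST: "S \<in> D" "T \<in> D"
    then have S: "S \<subseteq> P" "T \<subseteq> P" "\<Prod>S \<le> w" "\<Prod>T \<le> w" by (auto simp: D_def)
    have "\<Prod>(S \<union> T) * \<Prod>(S \<inter> T) = \<Prod>S * \<Prod>T" using fin S by (intro prod.union_inter) auto
    also have "\<dots> \<le> w\<^sup>2" using S by (simp add: power2_eq_square mult_le_mono)
    finally have le: "\<Prod>(S \<union> T) * \<Prod>(S \<inter> T) \<le> w\<^sup>2" .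
    have "p > 0" if "p \<in> S \<inter> T" for p using assms(2)[of p] S that by auto
    then have "\<Prod>(S \<inter> T) > 0" by (intro prod_pos) auto
    then have "\<Prod>(S \<union> T) \<le> \<Prod>(S \<union> T) * \<Prod>(S \<inter> T)" by simp
    then have "\<Prod>(S \<union> T) \<le> w\<^sup>2" using le by linarith
    then show "j (S, T) \<in> B" using S by (auto simp: j_def B_def D'_def)
  qed
  have "(\<Sum>S\<in>D. a S)\<^sup>2 = (\<Sum>(S, T)\<in>D \<times> D. a S * a T)"
    by (simp add: power2_eq_square sum_product sum.cartesian_product)
  also have "\<dots> = (\<Sum>x\<in>D \<times> D. f (j x))"
  proof (rule sum.cong[OF refl], clarify)
    fix S T assume "S \<in> D" "T \<in> D"
    then have "finite S" "finite T" using fin by (auto simp: D_def)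
    then show "a S * a T = f (j (S, T))"
      by (simp add: f_def j_def a_def prod.union_inter)
  qed
  also have "\<dots> = (\<Sum>x\<in>j ` (D \<times> D). f x)" using inj by (simp add: sum.reindex)
  also have "\<dots> \<le> (\<Sum>x\<in>B. f x)"
    using sub finB a0 by (intro sum_mono2) (auto simp: f_def)
  also have "\<dots> = (\<Sum>U\<in>D'. \<Sum>S\<in>Pow U. \<Sum>R\<in>Pow S. a U * a R)"
  proof -
    have "(\<Sum>U\<in>D'. \<Sum>S\<in>Pow U. \<Sum>R\<in>Pow S. a U * a R) = (\<Sum>U\<in>D'. \<Sum>(S, R)\<in>(SIGMA S:Pow U. Pow S). a U * a R)"
      using fin by (intro sum.cong refl sum.Sigma) (auto simp: D'_def intro: finite_subset)
    also have "\<dots> = (\<Sum>(U, S, R)\<in>B. a U * a R)"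
    proof -
      have "\<forall>U\<in>D'. finite (SIGMA S:Pow U. Pow S)" using fin by (auto simp: D'_def intro: finite_subset)
      from sum.Sigma[of D' "\<lambda>U. SIGMA S:Pow U. Pow S" "\<lambda>U (S, R). a U * a R", OF finD(2) this]
      show ?thesis unfolding B_def .
    qed
    finally show ?thesis by (simp add: f_def)
  qed
  also have "\<dots> \<le> (\<Sum>U\<in>D'. \<Prod>p\<in>U. (2 / real p) / (1 - 2 / real p))"
  proof (rule sum_mono)
    fix U assume "U \<in> D'"
    then have U: "U \<subseteq> P" "finite U" using fin by (auto simp: D'_def)
    have "(\<Sum>S\<in>Pow U. \<Sum>R\<in>Pow S. a U * a R) = a U * (\<Sum>S\<in>Pow U. \<Prod>p\<in>S. 1 / real p + 1)"
      unfolding sum_distrib_left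
    proof (intro sum.cong refl)
      fix S assume "S \<in> Pow U"
      then have "finite S" using U finite_subset by auto
      then show "(\<Sum>R\<in>Pow S. a U * a R) = a U * (\<Prod>p\<in>S. 1 / real p + 1)"
        by (simp add: prod_add a_def sum_distrib_left)
    qed
    also have "(\<Sum>S\<in>Pow U. \<Prod>p\<in>S. 1 / real p + 1) = (\<Prod>p\<in>U. (1 / real p + 1) + 1)"
      using prod_add[OF U(2), of "\<lambda>p. 1 / real p + 1" "\<lambda>_. 1"] by simp
    also have "a U * (\<Prod>p\<in>U. (1 / real p + 1) + 1) = (\<Prod>p\<in>U. 1 / real p * ((1 / real p + 1) + 1))"
      unfolding a_def by (rule prod.distrib[symmetric])
    \<comment> \<open>Factor by factor this is \<open>2/p + 1/p^2 \<le> 2/(p - 2)\<close>, valid for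
      \<open>p \<ge> 3\<close>.\<close>
    also have "\<dots> \<le> (\<Prod>p\<in>U. (2 / real p) / (1 - 2 / real p))"
    proof (rule prod_mono, safe)
      fix p assume "p \<in> U"
      then have "p \<ge> 3" using assms(2) U by auto
      then have "real p \<ge> 3" by simp
      then show "1 / real p * ((1 / real p + 1) + 1) \<le> (2 / real p) / (1 - 2 / real p)"
        by (simp add: divide_simps) (simp add: algebra_simps)
    qed auto
    finally show "(\<Sum>S\<in>Pow U. \<Sum>R\<in>Pow S. a U * a R) \<le> (\<Prod>p\<in>U. (2 / real p) / (1 - 2 / real p))" .
  qed
  finally show ?thesis by (simp add: D_def D'_def a_def)
qed

section \<open>The sieve applied to prime pairs\<close>

text \<open>Sift the \<open>n < N\<close> by the condition \<open>p dvd n * (n + h)\<close>. The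
  main term needs \<open>G\<close> to be at least of order \<open>(ln w / K)\<^sup>2\<close>;
  \<open>w ^ 8\<close> bounds the sieve error, and \<open>w ^ 2\<close> the primes too small to
  survive the sifting.\<close>

lemma prime_pairs_sieve_bound:
  fixes h w N :: nat
  assumes "h > 0" "w \<ge> 2"
  defines "K \<equiv> \<Prod>q\<in>prime_factors h. 1 + 1 / real q"
  shows "real (card {p. p < N \<and> prime p \<and> prime (p + h)})
    \<le> 9 * K\<^sup>2 * real N / (ln (real w))\<^sup>2 + real w ^ 8 + real w ^ 2"
proof -
  \<comment> \<open>Squaring \<open>H\<close>, whose sets have product at most \<open>w\<close>,
    produces sets of product up to \<open>w\<^sup>2\<close>; this is therefore the level of
    \<open>G\<close>.\<close>
  define z where "z = w\<^sup>2"
  define Pr where "Pr = {p::nat. prime p \<and> p \<le> z}"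
  \<comment> \<open>Excluding \<open>2\<close> keeps the density \<open>2 / p\<close> below
    \<open>1\<close>; for the prime factors of \<open>h\<close> the two roots would
    coincide.\<close>
  define P where "P = {p\<in>Pr. \<not> p dvd 2 * h}"
  define D where "D = {S. S \<subseteq> P \<and> \<Prod>S \<le> z}"
  define H where "H = (\<Sum>S | S \<subseteq> P \<and> \<Prod>S \<le> w. \<Prod>p\<in>S. 1 / real p)"
  define G where "G = (\<Sum>S\<in>D. \<Prod>p\<in>S. (2 / real p) / (1 - 2 / real p))"
  have "w \<le> z" unfolding z_def by (simp add: power2_nat_le_imp_le power2_eq_square)
  have finPr: "finite Pr" by (simp add: Pr_def)
  have finP: "finite P" using finPr by (simp add: P_def)
  have P3: "p \<ge> 3" if "p \<in> P" for p
  proof -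
    have "prime p" "\<not> p dvd 2 * h" using that by (auto simp: P_def Pr_def)
    then have "p \<noteq> 2" "p \<ge> 2" by (auto simp: prime_ge_2_nat)
    then show ?thesis by simp
  qed
  have Pprime: "prime p \<and> \<not> p dvd h" if "p \<in> P" for p using that by (auto simp: P_def Pr_def)
  have finS: "finite S" if "S \<in> D" for S using that finP finite_subset by (auto simp: D_def)
  have K1: "K \<ge> 1" unfolding K_def by (rule prod_ge_1) auto
  have H0: "H \<ge> 0" unfolding H_def by (intro sum_nonneg prod_nonneg) auto
  have lnw: "ln (real w) > 0" using assms(2) by simp
  have "ln (real w) \<le> ln (real w + 1)" using assms(2) by simp
  also have "\<dots> \<le> harm w" by (rule ln_le_harm)
  also have "\<dots> \<le> 2 * (\<Sum>S | S \<subseteq> Pr \<and> \<Prod>S \<le> w. \<Prod>p\<in>S. 1 / real p)"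
    using finPr \<open>w \<le> z\<close> by (intro harm_le_sum_squarefree) (auto simp: Pr_def)
  also have "\<dots> \<le> 2 * (H * (\<Prod>q\<in>Pr - P. 1 + 1 / real q))"
    unfolding H_def using finPr
    by (intro mult_left_mono sum_prime_subsets_split) (auto simp: P_def Pr_def prime_gt_0_nat)
  also have "\<dots> \<le> 2 * (H * (3 / 2 * K))"
  proof -
    \<comment> \<open>The excluded primes are \<open>2\<close> and prime factors of
      \<open>h\<close>. The prime \<open>2\<close> gives the factor \<open>3 / 2\<close>, unless
      \<open>K\<close> already contains it.\<close>
    have "(\<Prod>q\<in>Pr - P. 1 + 1 / real q) \<le> (\<Prod>q\<in>insert 2 (prime_factors h). 1 + 1 / real q)"
    proof (rule prod_mono2)
      show "Pr - P \<subseteq> insert 2 (prime_factors h)"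
      proof
        fix q assume "q \<in> Pr - P"
        then have "prime q" "q dvd 2 * h" by (auto simp: P_def Pr_def)
        then have "q dvd 2 \<or> q dvd h" by (simp add: prime_dvd_mult_iff)
        then show "q \<in> insert 2 (prime_factors h)"
          using \<open>prime q\<close> assms(1) by (auto simp: prime_factors_dvd primes_dvd_imp_eq)
      qed
    qed auto
    also have "\<dots> \<le> 3 / 2 * K"
    proof (cases "2 \<in> prime_factors h")
      case True
      then show ?thesis using K1 by (simp add: insert_absorb K_def)
    next
      case False
      then show ?thesis by (simp add: K_def)
    qed
    finally show ?thesis using H0 by (intro mult_left_mono) auto
  qed
  finally have lnH: "ln (real w) \<le> 3 * K * H" by (simp add: mult_ac)
  then have "(ln (real w))\<^sup>2 \<le> (3 * K * H)\<^sup>2" using lnw by (intro power_mono) auto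
  also have "\<dots> \<le> 9 * K\<^sup>2 * G"
  proof -
    have "H\<^sup>2 \<le> G" unfolding H_def G_def D_def z_def
      using finP P3 by (rule sum_prime_subsets_square)
    then show ?thesis using K1 by (simp add: power_mult_distrib)
  qed
  finally have G: "(ln (real w))\<^sup>2 \<le> 9 * K\<^sup>2 * G" .
  then have "9 * K\<^sup>2 * G > 0" using lnw by (meson less_le_trans zero_less_power)
  then have Gpos: "G > 0" using K1 by (simp add: zero_less_mult_iff)
  have "real (card {n\<in>{..<N}. \<forall>p\<in>P. n \<notin> {n. p dvd n * (n + h)}})
     \<le> real N / G + (\<Sum>S\<in>D. \<Sum>T\<in>D. (\<Prod>p\<in>S. 1 / (2 / real p)) * (\<Prod>p\<in>T. 1 / (2 / real p)) * 2 ^ card (S \<union> T))"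
    unfolding G_def
  proof (rule selberg_sieve)
    show "D \<subseteq> Pow P" by (auto simp: D_def)
    show "{} \<in> D" using assms(2) by (auto simp: D_def z_def)
    show "T \<in> D" if "S \<in> D" "T \<subseteq> S" for S T
    proof -
      have S: "S \<subseteq> P" "\<Prod>S \<le> z" using that by (auto simp: D_def)
      have "\<Prod>T dvd \<Prod>S" using finS that by (intro prod_dvd_prod_subset) auto
      moreover have "p > 0" if "p \<in> S" for p using S P3[of p] that by auto
      then have "\<Prod>S > 0" by (intro prod_pos) auto
      ultimately have "\<Prod>T \<le> \<Prod>S" by (rule dvd_imp_le)
      then show ?thesis using S that by (auto simp: D_def)
    qed
    show "0 < 2 / real p \<and> 2 / real p < 1" if "p \<in> P" for p using P3[OF that] by simp
    fix U assume U: "U \<subseteq> P"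
    have "{n \<in> {..<N}. \<forall>p\<in>U. n \<in> {n. p dvd n * (n + h)}} = {n. n < N \<and> (\<forall>p\<in>U. p dvd n * (n + h))}" by auto
    then show "\<bar>real (card {n \<in> {..<N}. \<forall>p\<in>U. n \<in> {n. p dvd n * (n + h)}}) - real N * (\<Prod>p\<in>U. 2 / real p)\<bar> \<le> 2 ^ card U"
      using card_divisible_approx[of U h N] U Pprime finite_subset[OF U finP] by auto
  qed (use finP in auto)
  also have "\<dots> \<le> 9 * K\<^sup>2 * real N / (ln (real w))\<^sup>2 + real w ^ 8"
  proof (rule add_mono)
    show "real N / G \<le> 9 * K\<^sup>2 * real N / (ln (real w))\<^sup>2"
      using mult_left_mono[OF G, of "real N"] lnw Gpos by (simp add: field_simps)
    \<comment> \<open>The powers of \<open>2\<close> cancel, so each term is at most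
      \<open>z\<^sup>2\<close>; with at most \<open>z\<close> sets in \<open>D\<close> the total is
      at most \<open>z ^ 4 = w ^ 8\<close>.\<close>
    have "(\<Sum>S\<in>D. \<Sum>T\<in>D. (\<Prod>p\<in>S. 1 / (2 / real p)) * (\<Prod>p\<in>T. 1 / (2 / real p)) * 2 ^ card (S \<union> T))
       \<le> (\<Sum>S\<in>D. \<Sum>T\<in>D. real z * real z)"
    proof (intro sum_mono)
      fix S T assume ST: "S \<in> D" "T \<in> D"
      have *: "(\<Prod>p\<in>S. 1 / (2 / real p)) = real (\<Prod>S) / 2 ^ card S" for S
        by (simp add: prod_dividef)
      have "(2::real) ^ card (S \<union> T) \<le> 2 ^ card S * 2 ^ card T"
        unfolding power_add[symmetric] by (intro power_increasing card_Un_le) auto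
      then have "(\<Prod>p\<in>S. 1 / (2 / real p)) * (\<Prod>p\<in>T. 1 / (2 / real p)) * 2 ^ card (S \<union> T)
         \<le> real (\<Prod>S) / 2 ^ card S * (real (\<Prod>T) / 2 ^ card T) * (2 ^ card S * 2 ^ card T)"
        unfolding * by (intro mult_left_mono mult_nonneg_nonneg divide_nonneg_nonneg of_nat_0_le_iff) auto
      also have "\<dots> = real (\<Prod>S) * real (\<Prod>T)" by simp
      also have "\<dots> \<le> real z * real z"
      proof -
        have "real (\<Prod>S) \<le> real z" "real (\<Prod>T) \<le> real z" using ST unfolding D_def of_nat_le_iff by auto
        then show ?thesis by (intro mult_mono of_nat_0_le_iff)
      qed
      finally show "(\<Prod>p\<in>S. 1 / (2 / real p)) * (\<Prod>p\<in>T. 1 / (2 / real p)) * 2 ^ card (S \<union> T) \<le> real z * real z" .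
    qed
    also have "\<dots> = real (card D) * real (card D) * (real z * real z)" by simp
    also have "\<dots> \<le> real z * real z * (real z * real z)"
      using card_prime_subsets_le[OF finP, of z] Pprime by (intro mult_right_mono mult_mono) (auto simp: D_def)
    also have "\<dots> = real w ^ 8" by (simp add: z_def power_numeral_reduce)
    finally show "(\<Sum>S\<in>D. \<Sum>T\<in>D. (\<Prod>p\<in>S. 1 / (2 / real p)) * (\<Prod>p\<in>T. 1 / (2 / real p)) * 2 ^ card (S \<union> T)) \<le> real w ^ 8" .
  qed
  finally have sieve: "real (card {n\<in>{..<N}. \<forall>p\<in>P. n \<notin> {n. p dvd n * (n + h)}})
     \<le> 9 * K\<^sup>2 * real N / (ln (real w))\<^sup>2 + real w ^ 8" .
  \<comment> \<open>If \<open>p > z\<close>, a sieving prime dividing \<open>p * (p + h)\<close>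
    would equal \<open>p\<close> or \<open>p + h\<close>, although it is at most
    \<open>z\<close>.\<close>
  have "{p. p < N \<and> prime p \<and> prime (p + h)} \<subseteq> {n\<in>{..<N}. \<forall>p\<in>P. n \<notin> {n. p dvd n * (n + h)}} \<union> {1..z}"
  proof
    fix p assume p: "p \<in> {p. p < N \<and> prime p \<and> prime (p + h)}"
    show "p \<in> {n\<in>{..<N}. \<forall>p\<in>P. n \<notin> {n. p dvd n * (n + h)}} \<union> {1..z}"
    proof (cases "p \<le> z")
      case True
      then show ?thesis using p prime_ge_1_nat by auto
    next
      case False
      have "\<not> q dvd p * (p + h)" if "q \<in> P" for q
      proof
        assume "q dvd p * (p + h)"
        moreover have q: "prime q" "q \<le> z" using that by (auto simp: P_def Pr_def)
        ultimately have "q dvd p \<or> q dvd p + h" by (simp add: prime_dvd_mult_iff)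
        then have "q = p \<or> q = p + h" using q p primes_dvd_imp_eq by blast
        then show False using q False by auto
      qed
      then show ?thesis using p by auto
    qed
  qed
  then have "card {p. p < N \<and> prime p \<and> prime (p + h)}
     \<le> card ({n\<in>{..<N}. \<forall>p\<in>P. n \<notin> {n. p dvd n * (n + h)}} \<union> {1..z})" by (intro card_mono) auto
  also have "\<dots> \<le> card {n\<in>{..<N}. \<forall>p\<in>P. n \<notin> {n. p dvd n * (n + h)}} + z"
    using card_Un_le[of _ "{1..z}"] by simp
  finally have "real (card {p. p < N \<and> prime p \<and> prime (p + h)})
     \<le> real (card {n\<in>{..<N}. \<forall>p\<in>P. n \<notin> {n. p dvd n * (n + h)}}) + real z" by linarith
  then show ?thesis using sieve by (simp add: z_def)
qed

text \<open>With \<open>w\<close> about \<open>N powr (1/16)\<close> the error \<open>w ^ 8\<close>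
  is about \<open>sqrt N\<close>, hence negligible, while \<open>ln w\<close> remains a fixed
  fraction of \<open>ln N\<close>; the value \<open>1/32\<close> leaves room for the
  rounding.\<close>

lemma prime_pairs_upper_bound:
  obtains C where "C > 0"
    "eventually (\<lambda>N. \<forall>h>0. real (card {p. p < N \<and> prime p \<and> prime (p + h)})
       \<le> C * (\<Prod>q\<in>prime_factors h. 1 + 1 / real q)\<^sup>2 * real N / (ln (real N))\<^sup>2) at_top"
proof -
  define w where "w = (\<lambda>N::nat. nat \<lfloor>real N powr (1/16)\<rfloor>)"
  have "eventually (\<lambda>N::nat. of_int \<lfloor>real N powr (1/16)\<rfloor> \<ge> (2::real)) at_top" by real_asymp
  moreover have "eventually (\<lambda>N::nat. ln (of_int \<lfloor>real N powr (1/16)\<rfloor>) \<ge> ln (real N) / 32) at_top" by real_asymp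
  moreover have "eventually (\<lambda>N::nat. (of_int \<lfloor>real N powr (1/16)\<rfloor>) ^ 8 + (of_int \<lfloor>real N powr (1/16)\<rfloor>) ^ 2
     \<le> real N / (ln (real N))\<^sup>2) at_top" by real_asymp
  moreover have "eventually (\<lambda>N::nat. ln (real N) > 0) at_top" by real_asymp
  ultimately have "eventually (\<lambda>N. \<forall>h>0. real (card {p. p < N \<and> prime p \<and> prime (p + h)})
       \<le> 9217 * (\<Prod>q\<in>prime_factors h. 1 + 1 / real q)\<^sup>2 * real N / (ln (real N))\<^sup>2) at_top"
  proof eventually_elim
    case (elim N)
    have w: "real (w N) = of_int \<lfloor>real N powr (1/16)\<rfloor>" by (simp add: w_def)
    show ?case
    proof (intro allI impI)
      fix h :: nat assume "h > 0"
      define K where "K = (\<Prod>q\<in>prime_factors h. 1 + 1 / real q)"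
      have K1: "K \<ge> 1" unfolding K_def by (rule prod_ge_1) auto
      have "w N \<ge> 2" using elim(1) w by linarith
      then have "real (card {p. p < N \<and> prime p \<and> prime (p + h)})
        \<le> 9 * K\<^sup>2 * real N / (ln (real (w N)))\<^sup>2 + real (w N) ^ 8 + real (w N) ^ 2"
        unfolding K_def by (intro prime_pairs_sieve_bound \<open>h > 0\<close>)
      also have "9 * K\<^sup>2 * real N / (ln (real (w N)))\<^sup>2 \<le> 9 * K\<^sup>2 * real N / (ln (real N) / 32)\<^sup>2"
      proof -
        have "ln (real (w N)) \<ge> ln (real N) / 32" using elim(2) w by simp
        moreover have "ln (real (w N)) > 0" using elim(4) calculation by linarith
        ultimately show ?thesis using elim(4)
          by (intro divide_left_mono power_mono mult_pos_pos zero_less_power) auto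
      qed
      \<comment> \<open>\<open>9216 = 9 * 32\<^sup>2\<close>; the remaining \<open>1\<close> in
        \<open>9217\<close> absorbs the error terms, using \<open>K \<ge> 1\<close>.\<close>
      also have "\<dots> = 9216 * (K\<^sup>2 * real N / (ln (real N))\<^sup>2)" by (simp add: power2_eq_square)
      also have "9216 * (K\<^sup>2 * real N / (ln (real N))\<^sup>2) + real (w N) ^ 8 + real (w N) ^ 2
         \<le> 9216 * (K\<^sup>2 * real N / (ln (real N))\<^sup>2) + 1 * real N / (ln (real N))\<^sup>2"
        using elim(3) by (simp add: w)
      also have "1 * real N / (ln (real N))\<^sup>2 \<le> K\<^sup>2 * real N / (ln (real N))\<^sup>2"
        using K1 by (intro divide_right_mono mult_right_mono) auto
      finally show "real (card {p. p < N \<and> prime p \<and> prime (p + h)}) \<le> 9217 * K\<^sup>2 * real N / (ln (real N))\<^sup>2"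
        by (simp add: mult_ac)
    qed
  qed
  then show ?thesis by (intro that[of 9217]) auto
qed

section \<open>Chebyshev-type estimates\<close>

lemma prod_primes_dvd:
  fixes S :: "nat set"
  assumes "finite S" "\<And>p. p \<in> S \<Longrightarrow> prime p \<and> p dvd m"
  shows "\<Prod>S dvd m"
  using assms
proof (induction S rule: finite_induct)
  case (insert p F)
  have "coprime p (\<Prod>F)"
    using insert by (intro prod_coprime_right) (metis insertCI primes_coprime)
  then show ?case using insert by (auto intro!: divides_mult)
qed simp

text \<open>The product of distinct prime divisors still divides \<open>m\<close>. Used for central
  binomial coefficients, for \<open>2 ^ k - 1\<close>, and for differences of exponent sums.\<close>

lemma power_card_primes_le:
  fixes S :: "nat set"
  assumes "finite S" "\<And>p. p \<in> S \<Longrightarrow> prime p \<and> p dvd m \<and> b \<le> p" "m > 0"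
  shows "b ^ card S \<le> m"
proof -
  have "b ^ card S = (\<Prod>p\<in>S. b)" by simp
  also have "\<dots> \<le> \<Prod>S" using assms(2) by (intro prod_mono) auto
  also have "\<dots> \<le> m" using assms by (intro dvd_imp_le prod_primes_dvd) auto
  finally show ?thesis .
qed

text \<open>With \<open>n = 2 ^ j\<close>, every prime between \<open>n\<close> and
  \<open>2 * n\<close> divides the central binomial coefficient, which is at most
  \<open>4 ^ n\<close>.\<close>

lemma card_primes_dyadic:
  "j * card {p::nat. prime p \<and> 2 ^ j < p \<and> p \<le> 2 ^ Suc j} \<le> 2 ^ Suc j"
proof -
  define n :: nat where "n = 2 ^ j"
  define S where "S = {p. prime p \<and> n < p \<and> p \<le> 2 * n}"
  have "p dvd 2 * n choose n" if "p \<in> S" for p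
  proof -
    have p: "prime p" "n < p" "p \<le> 2 * n" using that by (auto simp: S_def)
    have "p dvd fact (2 * n)" using p by (simp add: prime_dvd_fact_iff)
    also have "fact (2 * n) = fact n * fact n * (2 * n choose n)"
      using binomial_fact_lemma[of n "2 * n"] by (simp add: mult_ac)
    finally show ?thesis using p by (simp add: prime_dvd_mult_iff prime_dvd_fact_iff)
  qed
  then have "n ^ card S \<le> 2 * n choose n"
    by (intro power_card_primes_le) (auto simp: S_def)
  also have "\<dots> \<le> 2 ^ (2 * n)" by (rule binomial_le_pow2)
  finally have "(2::nat) ^ (j * card S) \<le> 2 ^ (2 * n)" by (simp add: n_def power_mult)
  then show ?thesis by (simp add: n_def S_def)
qed

text \<open>The prime \<open>2\<close> gives \<open>1 / 2\<close>. The block above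
  \<open>2 ^ j\<close> has at most \<open>2 ^ Suc j / j\<close> primes, each contributing at most
  \<open>1 / 2 ^ j\<close>, hence \<open>2 / j\<close> in total.\<close>

lemma sum_inverse_primes_dyadic:
  assumes "J \<ge> 1"
  shows "(\<Sum>p | prime p \<and> p \<le> 2 ^ J. 1 / real p) \<le> 1 / 2 + 2 * harm (J - 1)"
  using assms
proof (induction J rule: nat_induct_at_least)
  case base
  have "{p::nat. prime p \<and> p \<le> 2} = {2}" by (auto simp: prime_ge_2_nat antisym)
  then show ?case by (simp add: harm_def)
next
  case (Suc J)
  define S where "S = {p::nat. prime p \<and> 2 ^ J < p \<and> p \<le> 2 ^ Suc J}"
  have "{p::nat. prime p \<and> p \<le> 2 ^ Suc J} = {p. prime p \<and> p \<le> 2 ^ J} \<union> S"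
    unfolding S_def by (auto simp: not_le)
  then have "(\<Sum>p | prime p \<and> p \<le> 2 ^ Suc J. 1 / real p)
     = (\<Sum>p | prime p \<and> p \<le> 2 ^ J. 1 / real p) + (\<Sum>p\<in>S. 1 / real p)"
    by (simp only:) (subst sum.union_disjoint, auto simp: S_def)
  moreover have "(\<Sum>p\<in>S. 1 / real p) \<le> real (card S) * (1 / 2 ^ J)"
  proof (rule sum_bounded_above)
    fix p assume "p \<in> S"
    then have "2 ^ J \<le> p" "p > 0" by (simp_all add: S_def prime_gt_0_nat)
    then have "2 ^ J \<le> real p" by (metis of_nat_le_iff of_nat_numeral of_nat_power)
    then show "1 / real p \<le> 1 / 2 ^ J" by (intro divide_left_mono) (use \<open>p > 0\<close> in auto)
  qed
  moreover have "real (card S) * (1 / 2 ^ J) \<le> 2 / real J"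
  proof -
    have "real (J * card S) \<le> real (2 ^ Suc J)" using card_primes_dyadic[of J] unfolding S_def of_nat_le_iff .
    then show ?thesis using Suc.hyps by (simp add: field_simps)
  qed
  moreover have "harm J = harm (J - 1) + inverse (real J)"
    using harm_Suc[of "J - 1"] Suc.hyps by simp
  ultimately show ?case using Suc.IH by (simp add: inverse_eq_divide)
qed

lemma harm_le_ln: "n \<ge> 1 \<Longrightarrow> (harm n :: real) \<le> 1 + ln (real n)"
proof (induction n rule: nat_induct_at_least)
  case (Suc n)
  have "ln (real n / real (Suc n)) \<le> real n / real (Suc n) - 1" using Suc.hyps by (intro ln_le_minus_one) auto
  also have "\<dots> = - inverse (real (Suc n))" by (simp add: field_simps)
  finally have "inverse (real (Suc n)) \<le> ln (real (Suc n)) - ln (real n)"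
    using Suc.hyps by (subst (asm) ln_div) auto
  then show ?case using Suc.IH unfolding harm_Suc by linarith
qed (simp add: harm_def)

text \<open>
  The primes of \<open>Q\<close> up to \<open>2\<^sup>J\<close> contribute a factor \<open>O(J\<^sup>4)\<close>, and the larger ones a bounded
  factor, provided that \<open>J\<^sup>4\<close> is about the size of the sum on the right.
\<close>

lemma prod_one_plus_inverse_le:
  obtains C where "C > 0" "\<And>Q. finite Q \<Longrightarrow> (\<And>q. q \<in> Q \<Longrightarrow> prime q) \<Longrightarrow>
    (\<Prod>q\<in>Q. 1 + 1 / real q)\<^sup>2 \<le> C * (1 + (\<Sum>q\<in>Q. real q powr (-11/12)))"
proof -
  have "(\<lambda>J::nat. real J ^ 4 * 2 powr (- real J / 12)) \<longlonglongrightarrow> 0" by real_asymp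
  then have "Bseq (\<lambda>J::nat. real J ^ 4 * 2 powr (- real J / 12))"
    by (intro convergent_imp_Bseq) (auto simp: convergent_def)
  then obtain B where B: "\<And>J::nat. real J ^ 4 * 2 powr (- real J / 12) \<le> B"
    by (auto simp: Bseq_def)
  have main: "(\<Prod>q\<in>Q. 1 + 1 / real q)\<^sup>2 \<le> (exp (5 + 2 * B) * 16) * (1 + (\<Sum>q\<in>Q. real q powr (-11/12)))"
    if Q: "finite Q" "\<And>q. q \<in> Q \<Longrightarrow> prime q" for Q :: "nat set"
  proof -
    define T where "T = (\<Sum>q\<in>Q. real q powr (-11/12))"
    define P where "P = (\<lambda>J::nat. J \<ge> 1 \<and> T \<le> real J ^ 4)"
    \<comment> \<open>Minimality makes \<open>J ^ 4\<close> comparable to \<open>1 + T\<close>: for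
      \<open>J \<ge> 2\<close> it gives \<open>(J - 1) ^ 4 \<le> T\<close>, and
      \<open>J \<le> 2 * (J - 1)\<close>.\<close>
    define J where "J = (LEAST J. P J)"
    have T0: "T \<ge> 0" unfolding T_def by (intro sum_nonneg) auto
    obtain n :: nat where n: "T \<le> real n" using real_arch_simple by blast
    have "real n \<le> real (n + 1) ^ 4"
      using power_increasing[of 1 4 "real (n + 1)"] by simp
    with n have "P (n + 1)" by (simp add: P_def)
    then have J: "P J" unfolding J_def by (rule LeastI)
    have J4: "real J ^ 4 \<le> 16 * (1 + T)"
    proof (cases "J = 1")
      case False
      then have "J \<ge> 2" using J by (simp add: P_def)
      have "\<not> P (J - 1)" using not_less_Least[of "J - 1" P] \<open>J \<ge> 2\<close> by (simp add: J_def)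
      moreover have "J - 1 \<ge> 1" using \<open>J \<ge> 2\<close> by simp
      ultimately have T: "real (J - 1) ^ 4 \<le> T" unfolding P_def by linarith
      have "real J ^ 4 \<le> (2 * real (J - 1)) ^ 4" using \<open>J \<ge> 2\<close> by (intro power_mono) auto
      also have "\<dots> = 16 * real (J - 1) ^ 4" by (simp add: power_mult_distrib)
      also have "\<dots> \<le> 16 * T" using T by simp
      finally show ?thesis by simp
    qed (use T0 in simp)
    have "{q \<in> Q. q \<le> 2 ^ J} \<union> {q \<in> Q. \<not> q \<le> 2 ^ J} = Q" by auto
    then have "(\<Sum>q\<in>Q. 1 / real q) = (\<Sum>q\<in>{q \<in> Q. q \<le> 2 ^ J} \<union> {q \<in> Q. \<not> q \<le> 2 ^ J}. 1 / real q)"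
      by (simp only:)
    also have "\<dots> = (\<Sum>q | q \<in> Q \<and> q \<le> 2 ^ J. 1 / real q) + (\<Sum>q | q \<in> Q \<and> \<not> q \<le> 2 ^ J. 1 / real q)"
      using Q(1) by (intro sum.union_disjoint) auto
    also have "(\<Sum>q | q \<in> Q \<and> q \<le> 2 ^ J. 1 / real q) \<le> (\<Sum>q | prime q \<and> q \<le> 2 ^ J. 1 / real q)"
      using Q(2) by (intro sum_mono2) auto
    also have "\<dots> \<le> 1 / 2 + 2 * harm (J - 1)" using J by (intro sum_inverse_primes_dyadic) (simp add: P_def)
    also have "harm (J - 1) \<le> (harm J :: real)" by (intro harm_mono) simp
    also have "harm J \<le> 1 + ln (real J)" using J by (intro harm_le_ln) (simp add: P_def)
    also have "(\<Sum>q | q \<in> Q \<and> \<not> q \<le> 2 ^ J. 1 / real q)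
        \<le> (\<Sum>q | q \<in> Q \<and> \<not> q \<le> 2 ^ J. real q powr (-11/12) * 2 powr (- real J / 12))"
    proof (rule sum_mono, clarify)
      fix q assume "q \<in> Q" "\<not> q \<le> 2 ^ J"
      then have "2 ^ J \<le> q" by simp
      then have q: "2 ^ J \<le> real q" by (metis of_nat_le_iff of_nat_numeral of_nat_power)
      then have q0: "real q > 0" by (rule less_le_trans[rotated]) simp
      \<comment> \<open>The spare exponent \<open>1/12\<close> yields the decay
        \<open>2 powr (- J / 12)\<close>, which outweighs \<open>T \<le> J ^ 4\<close>; hence the
        bound \<open>B\<close> on the tail.\<close>
      have "1 / real q = real q powr (-11/12) * real q powr (- 1/12)"
        using q0 by (simp add: powr_add[symmetric] powr_minus_divide)
      also have "real q powr (- 1/12) \<le> (2 ^ J) powr (- 1/12)"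
        using q by (intro powr_mono2') auto
      also have "((2::real) ^ J) powr (- 1/12) = 2 powr (- real J / 12)"
        by (simp add: powr_realpow[symmetric] powr_powr)
      finally show "1 / real q \<le> real q powr (-11/12) * 2 powr (- real J / 12)"
        by (simp add: mult_left_mono)
    qed
    also have "\<dots> \<le> T * 2 powr (- real J / 12)"
      unfolding T_def sum_distrib_right using Q(1) by (intro sum_mono2) auto
    also have "\<dots> \<le> real J ^ 4 * 2 powr (- real J / 12)"
      using J by (intro mult_right_mono) (auto simp: P_def)
    also have "\<dots> \<le> B" by (rule B)
    finally have S: "2 * (\<Sum>q\<in>Q. 1 / real q) \<le> (5 + 2 * B) + 4 * ln (real J)" by simp
    have "(\<Prod>q\<in>Q. 1 + 1 / real q)\<^sup>2 \<le> (\<Prod>q\<in>Q. exp (1 / real q))\<^sup>2"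
      by (intro power_mono prod_mono prod_nonneg) auto
    also have "\<dots> = exp (2 * (\<Sum>q\<in>Q. 1 / real q))"
      using Q(1) by (simp add: exp_sum exp_double)
    also have "\<dots> \<le> exp ((5 + 2 * B) + 4 * ln (real J))" using S by simp
    also have "\<dots> = exp (5 + 2 * B) * real J ^ 4"
    proof -
      have "exp (4 * ln (real J)) = real J ^ 4"
        using J exp_of_nat_mult[of 4 "ln (real J)"] by (simp add: P_def)
      then show ?thesis by (simp add: exp_add)
    qed
    also have "\<dots> \<le> exp (5 + 2 * B) * (16 * (1 + T))" using J4 by (intro mult_left_mono) auto
    finally show ?thesis by (simp add: T_def algebra_simps)
  qed
  show ?thesis using that[OF _ main] by simp
qed

section \<open>Chebyshev's lower bound\<close>

text \<open>
  The numbers \<open>1 / ((n + 1) * (n choose k))\<close> form Leibniz's harmonic triangle, each entry of which is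
  the difference of two entries with smaller \<open>k\<close>.
\<close>

lemma Suc_times_binomial_dvd:
  assumes "k \<le> n" "\<And>j. 1 \<le> j \<Longrightarrow> j \<le> Suc n \<Longrightarrow> j dvd D"
  shows "Suc n * (n choose k) dvd D"
  using assms
proof (induction k arbitrary: n)
  case (Suc k)
  then obtain m where n: "n = Suc m" by (cases n) auto
  have "Suc m * (m choose k) dvd D" using Suc.prems n by (intro Suc.IH) auto
  then obtain s where s: "D = Suc m * (m choose k) * s" by blast
  have "Suc n * (n choose k) dvd D" using Suc.prems by (intro Suc.IH) auto
  then obtain t where t: "D = Suc n * (n choose k) * t" by blast
  have km: "k \<le> m" using Suc.prems n by simp
  define a where "a = real (m choose k)"
  define b where "b = real (n choose k)"
  define c where "c = real (n choose Suc k)"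
  have pos: "a > 0" "b > 0" "c > 0" using km n unfolding a_def b_def c_def of_nat_0_less_iff
    by (auto intro!: zero_less_binomial simp del: binomial_Suc_Suc)
  have 1: "(real n - real k) * b = real n * a"
  proof -
    have "real ((n - k) * (n choose k)) = real (n * (m choose k))"
      using binomial_absorb_comp[of n k] n by simp
    moreover have "k \<le> n" using km n by simp
    ultimately show ?thesis by (simp only: a_def b_def of_nat_diff of_nat_mult)
  qed
  have 2: "real (Suc k) * c = real n * a"
  proof -
    have "real (Suc k * (n choose Suc k)) = real (n * (m choose k))"
      unfolding n by (simp only: Suc_times_binomial)
    then show ?thesis by (simp only: a_def c_def of_nat_mult)
  qed
  have s': "real D = real n * a * real s" by (simp only: s n a_def of_nat_mult)
  have t': "real D = real (Suc n) * b * real t" by (simp only: t b_def of_nat_mult)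
  \<comment> \<open>The recurrence of the harmonic triangle multiplied by \<open>D\<close>:
    \<open>D / ((n + 1) * c)\<close> is the difference of \<open>s = D / (n * a)\<close> and
    \<open>t = D / ((n + 1) * b)\<close>.\<close>
  have "real (Suc n) * c * (real s - real t) = real D"
  proof -
    have "real (Suc k) * (real (Suc n) * c * real s) = real (Suc n) * (real (Suc k) * c) * real s"
      by (simp only: mult_ac)
    also have "\<dots> = real (Suc n) * real D" unfolding 2 s' by (simp only: mult_ac)
    finally have s'': "real (Suc k) * (real (Suc n) * c * real s) = real (Suc n) * real D" .
    have "real (Suc k) * (real (Suc n) * c * real t) = real (Suc n) * (real (Suc k) * c) * real t"
      by (simp only: mult_ac)
    also have "\<dots> = (real n - real k) * real D" unfolding 2 1[symmetric] t' by (simp only: mult_ac)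
    finally have "real (Suc k) * (real (Suc n) * c * (real s - real t)) = real (Suc k) * real D"
      using s'' by (simp add: algebra_simps)
    then show ?thesis by (simp only: mult_cancel_left of_nat_eq_0_iff) simp
  qed
  \<comment> \<open>This makes the subtraction \<open>s - t\<close> of natural numbers
    exact.\<close>
  moreover from this have "s \<ge> t"
  proof -
    have "real (Suc n) * c * (real s - real t) \<ge> 0" using calculation by simp
    moreover have "real (Suc n) * c > 0" using pos(3) by simp
    ultimately have "real s - real t \<ge> 0" by (simp only: zero_le_mult_iff) linarith
    then show ?thesis by simp
  qed
  ultimately have "real D = real (Suc n * (n choose Suc k) * (s - t))"
    by (simp only: of_nat_mult of_nat_diff c_def)
  then have "D = Suc n * (n choose Suc k) * (s - t)" by (simp only: of_nat_eq_iff)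
  then show ?case by simp
qed simp

text \<open>The witness is the least common multiple of \<open>1, ..., n\<close>: each prime up to
  \<open>n\<close> enters with its largest power not exceeding \<open>n\<close>, so each factor is
  at most \<open>n\<close>.\<close>

lemma common_multiple_le_power_primes:
  obtains D :: nat where "D > 0" "D \<le> n ^ card {p. prime p \<and> p \<le> n}" "\<And>j. 1 \<le> j \<Longrightarrow> j \<le> n \<Longrightarrow> j dvd D"
proof -
  define P where "P = {p. prime p \<and> p \<le> n}"
  define e where "e = (\<lambda>p. Max {k. p ^ k \<le> n})"
  define D where "D = (\<Prod>p\<in>P. p ^ e p)"
  have finP: "finite P" by (simp add: P_def)
  have fin: "finite {k. p ^ k \<le> n}" if "prime p" for p
  proof -
    have "{k. p ^ k \<le> n} \<subseteq> {..n}"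
    proof
      fix k assume "k \<in> {k. p ^ k \<le> n}"
      moreover have "k < p ^ k" using prime_gt_1_nat[OF that] power_gt_expt[of p k] by simp
      ultimately show "k \<in> {..n}" by simp
    qed
    then show ?thesis using finite_atMost finite_subset by blast
  qed
  have le: "p ^ e p \<le> n" if "p \<in> P" for p
  proof -
    have "prime p" "p ^ 1 \<le> n" using that by (auto simp: P_def)
    then have "{k. p ^ k \<le> n} \<noteq> {}" by blast
    then show ?thesis using Max_in[OF fin[OF \<open>prime p\<close>]] by (auto simp: e_def)
  qed
  show ?thesis
  proof
    show "D > 0" unfolding D_def by (intro prod_pos) (auto simp: P_def prime_gt_0_nat)
    have "D \<le> (\<Prod>p\<in>P. n)" unfolding D_def using le by (intro prod_mono) auto
    then show "D \<le> n ^ card {p. prime p \<and> p \<le> n}" by (simp add: P_def)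
    fix j :: nat assume j: "1 \<le> j" "j \<le> n"
    have sub: "prime_factors j \<subseteq> P" using j by (auto simp: P_def intro: order_trans[OF dvd_imp_le])
    have "j = (\<Prod>p\<in>prime_factors j. p ^ multiplicity p j)" using j by (intro prime_factorization_nat) auto
    also have "\<dots> dvd (\<Prod>p\<in>prime_factors j. p ^ e p)"
    proof (rule prod_dvd_prod, rule le_imp_power_dvd)
      fix p assume p: "p \<in> prime_factors j"
      have "p ^ multiplicity p j \<le> j" using j by (intro dvd_imp_le multiplicity_dvd) auto
      then show "multiplicity p j \<le> e p" unfolding e_def using j p by (intro Max_ge fin) auto
    qed
    also have "\<dots> dvd D" unfolding D_def using sub finP by (intro prod_dvd_prod_subset) auto
    finally show "j dvd D" .
  qed
qed

text \<open>The common multiple of \<open>1, ..., 2 * m + 1\<close> is divisible by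
  \<open>Suc (2 * m)\<close> times the central binomial coefficient, and this factor compensates the
  loss of \<open>2 * m\<close> in the lower bound \<open>4 ^ m / (2 * m)\<close>.\<close>

lemma four_power_le_power_primes:
  assumes "m > 0"
  shows "4 ^ m \<le> (2 * m + 1) ^ card {p. prime p \<and> p \<le> 2 * m + 1}"
proof -
  obtain D :: nat where D: "D > 0" "D \<le> (2 * m + 1) ^ card {p. prime p \<and> p \<le> 2 * m + 1}"
    "\<And>j. 1 \<le> j \<Longrightarrow> j \<le> 2 * m + 1 \<Longrightarrow> j dvd D"
    using common_multiple_le_power_primes[of "2 * m + 1"] by blast
  have "4 ^ m / (2 * real m) \<le> real (2 * m choose m)" using assms by (rule central_binomial_lower_bound)
  then have "4 ^ m \<le> real (2 * m * (2 * m choose m))" using assms by (simp add: field_simps)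
  then have "real (4 ^ m) \<le> real (2 * m * (2 * m choose m))" by simp
  then have "4 ^ m \<le> 2 * m * (2 * m choose m)" by (simp only: of_nat_le_iff)
  also have "\<dots> \<le> Suc (2 * m) * (2 * m choose m)" by simp
  also have "\<dots> \<le> D" using D assms by (intro dvd_imp_le Suc_times_binomial_dvd) auto
  finally show ?thesis using D(2) by linarith
qed

lemma chebyshev_lower_bound:
  "eventually (\<lambda>N. real (card {p. p < N \<and> prime p}) \<ge> 1 / 4 * real N / ln (real N)) at_top"
  using eventually_ge_at_top[of 6]
proof eventually_elim
  case (elim N)
  \<comment> \<open>The largest \<open>m\<close> with \<open>2 * m + 1 < N\<close>; for
    \<open>N \<ge> 6\<close> it is at least \<open>N / 4\<close>.\<close>
  define m where "m = (N - 2) div 2"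
  define c where "c = card {p. prime p \<and> p \<le> 2 * m + 1}"
  have m: "m > 0" "2 * m + 1 < N" "real m \<ge> (real N - 3) / 2" using elim by (auto simp: m_def)
  have "4 ^ m \<le> (2 * m + 1) ^ c" unfolding c_def using m(1) by (rule four_power_le_power_primes)
  then have "real (4 ^ m) \<le> real ((2 * m + 1) ^ c)" by (simp only: of_nat_le_iff)
  also have "\<dots> \<le> real N ^ c" using m by (simp, intro power_mono) auto
  finally have "ln (real (4 ^ m)) \<le> ln (real N ^ c)" using elim by (subst ln_le_cancel_iff) auto
  then have "real m * ln 4 \<le> real c * ln (real N)" using elim by (simp add: ln_realpow)
  moreover have "ln (4::real) \<ge> 1"
  proof -
    have "ln (4::real) = 2 * ln 2" using ln_realpow[of "2::real" 2] by simp
    then show ?thesis using ln2_ge_two_thirds by simp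
  qed
  then have "real m * 1 \<le> real m * ln 4" by (intro mult_left_mono) auto
  moreover have "real N / 4 \<le> real m" using m(3) elim by simp
  ultimately have "real N / 4 \<le> real c * ln (real N)" by linarith
  moreover have "c \<le> card {p. p < N \<and> prime p}" unfolding c_def using m(2) by (intro card_mono) auto
  then have "real c * ln (real N) \<le> real (card {p. p < N \<and> prime p}) * ln (real N)"
    using elim by (intro mult_right_mono) auto
  ultimately have "real N / 4 \<le> real (card {p. p < N \<and> prime p}) * ln (real N)" by linarith
  then show ?case using elim by (simp add: field_simps)
qed

section \<open>Orders of 2 and squares in residue classes\<close>

lemma card_residue_class_le:
  fixes S :: "nat set"
  assumes "S \<subseteq> {..M}" "\<And>m n. m \<in> S \<Longrightarrow> n \<in> S \<Longrightarrow> m mod g = n mod g"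
  shows "card S \<le> M div g + 1"
proof -
  have "inj_on (\<lambda>m. m div g) S"
    by (rule inj_onI) (metis assms(2) div_mult_mod_eq)
  moreover have "(\<lambda>m. m div g) ` S \<subseteq> {..M div g}" using assms(1) by (auto intro: div_le_mono)
  ultimately have "card S \<le> card {..M div g}" by (intro card_inj_on_le) auto
  then show ?thesis by simp
qed

text \<open>
  If \<open>m\<^sup>2 = m\<^sub>0\<^sup>2\<close> modulo \<open>e\<close> then \<open>e = g * g'\<close> with \<open>g\<close> dividing \<open>m - m\<^sub>0\<close> and \<open>g'\<close> dividing
  \<open>m + m\<^sub>0\<close>, and one of \<open>g\<close>, \<open>g'\<close> is at least \<open>sqrt e\<close>.
\<close>

lemma card_square_class_le:
  assumes "e > 0"
  shows "real (card {m. m \<le> M \<and> m\<^sup>2 mod e = r}) \<le> real (card {g. g dvd e}) * (real M / sqrt (real e) + 1)"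
proof (cases "{m. m \<le> M \<and> m\<^sup>2 mod e = r} = {}")
  case False
  define S where "S = {m. m \<le> M \<and> m\<^sup>2 mod e = r}"
  obtain m0 where m0: "m0 \<in> S" using False by (auto simp: S_def)
  define T where "T = (\<lambda>g. {m. m \<le> M \<and> m mod g = m0 mod g \<and> e div g dvd m + m0})"
  have fin: "finite {g. g dvd e}" using assms by simp
  have "S \<subseteq> (\<Union>g\<in>{g. g dvd e}. T g)"
  proof
    fix m assume m: "m \<in> S"
    \<comment> \<open>The argument passes to integers because \<open>m - m0\<close> may be negative.
      A divisor of a product splits into divisors of the two factors.\<close>
    then have "int (m\<^sup>2 mod e) = int (m0\<^sup>2 mod e)" using m0 by (simp add: S_def)
    then have "int (m\<^sup>2) mod int e = int (m0\<^sup>2) mod int e" by (simp only: of_nat_mod)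
    then have "int e dvd int (m\<^sup>2) - int (m0\<^sup>2)" by (simp only: mod_eq_dvd_iff)
    also have "int (m\<^sup>2) - int (m0\<^sup>2) = (int m - int m0) * (int m + int m0)"
      by (simp add: power2_eq_square algebra_simps)
    finally obtain b c where bc: "int e = b * c" "b dvd int m - int m0" "c dvd int m + int m0"
      using division_decomp by blast
    define g where "g = nat \<bar>b\<bar>"
    have "e = g * nat \<bar>c\<bar>" using bc(1) unfolding g_def by (metis abs_mult nat_abs_int_diff nat_int nat_mult_distrib abs_ge_zero abs_of_nat)
    moreover from this have "g > 0" using assms by (auto intro!: Nat.gr0I)
    ultimately have g: "g dvd e" "e div g = nat \<bar>c\<bar>" by simp_all
    have "int g dvd int m - int m0" using bc(2) by (simp add: g_def)
    then have "int m mod int g = int m0 mod int g" by (simp only: mod_eq_dvd_iff)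
    then have "m mod g = m0 mod g" by (simp flip: of_nat_mod)
    moreover have "int (e div g) dvd int (m + m0)" using bc(3) g(2) by simp
    then have "e div g dvd m + m0" by (simp only: of_nat_dvd_iff)
    ultimately show "m \<in> (\<Union>g\<in>{g. g dvd e}. T g)" using m g by (auto simp: T_def S_def)
  qed
  then have "card S \<le> card (\<Union>g\<in>{g. g dvd e}. T g)" using fin by (intro card_mono) (auto simp: T_def)
  also have "\<dots> \<le> (\<Sum>g | g dvd e. card (T g))" using fin by (rule card_UN_le)
  finally have "real (card S) \<le> (\<Sum>g | g dvd e. real (card (T g)))" by (simp flip: of_nat_sum)
  also have "\<dots> \<le> (\<Sum>g | g dvd e. real M / sqrt (real e) + 1)"
  proof (rule sum_mono)
    fix g assume "g \<in> {g. g dvd e}"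
    then obtain g' where g': "e = g * g'" by auto
    then have pos: "g > 0" "g' > 0" using assms by auto
    have g'_eq: "e div g = g'" using g' pos by simp
    have bound: "real (card (T g)) \<le> real M / sqrt (real e) + 1"
      if d: "d > 0" "e \<le> d * d" "card (T g) \<le> M div d + 1" for d
    proof -
      have "real e \<le> (real d)\<^sup>2" using d(2) by (metis of_nat_le_iff of_nat_mult power2_eq_square)
      then have "sqrt (real e) \<le> real d" using real_le_lsqrt by simp
      then have "real M / real d \<le> real M / sqrt (real e)" using assms d(1) by (intro divide_left_mono) auto
      moreover have "real (card (T g)) \<le> real (M div d) + 1" using d(3) by linarith
      moreover have "real (M div d) \<le> real M / real d" by (rule of_nat_div_le_of_nat)
      ultimately show ?thesis by linarith
    qed
    have "card (T g) \<le> M div g + 1" by (intro card_residue_class_le) (auto simp: T_def)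
    moreover have "card (T g) \<le> M div g' + 1"
    proof (rule card_residue_class_le)
      fix m n assume "m \<in> T g" "n \<in> T g"
      then have "g' dvd m + m0" "g' dvd n + m0" by (auto simp: T_def g'_eq)
      then have "[m + m0 = n + m0] (mod g')" by (simp add: unique_euclidean_semiring_class.cong_def)
      then have "[m = n] (mod g')" by (simp add: cong_add_rcancel_nat)
      then show "m mod g' = n mod g'" by (simp add: unique_euclidean_semiring_class.cong_def)
    qed (auto simp: T_def)
    moreover have "e \<le> g * g \<or> e \<le> g' * g'" unfolding g' by (cases "g \<le> g'") auto
    ultimately show "real (card (T g)) \<le> real M / sqrt (real e) + 1" using bound pos by blast
  qed
  finally show ?thesis by (simp add: S_def)
next
  case True
  show ?thesis unfolding True by simp
qed

section \<open>Primes modulo which 2 has a given order\<close>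

text \<open>All these primes divide \<open>2 ^ k - 1\<close>, and each is at least
  \<open>2\<close>.\<close>

lemma card_primes_of_order_le:
  fixes S :: "nat set"
  assumes "k > 0" "finite S" "\<And>q. q \<in> S \<Longrightarrow> prime q \<and> ord q 2 = k"
  shows "card S \<le> k"
proof -
  have "2 ^ card S \<le> (2::nat) ^ k - 1"
  proof (rule power_card_primes_le[OF assms(2)])
    fix q assume q: "q \<in> S"
    have "[2 ^ k = 1] (mod q)" using assms(3)[OF q] ord_divides[of 2 k q] by simp
    then have "q dvd 2 ^ k - 1" by (simp add: cong_altdef_nat)
    then show "prime q \<and> q dvd 2 ^ k - 1 \<and> 2 \<le> q" using assms(3)[OF q] by (auto simp: prime_ge_2_nat)
  next
    show "2 ^ k - 1 > (0::nat)" using assms(1) one_less_power[of "2::nat" k] by simp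
  qed
  also have "\<dots> \<le> 2 ^ k" by simp
  finally show ?thesis by simp
qed

text \<open>For \<open>j \<le> k\<close>, a factor \<open>k powr (1/6)\<close> buys the summable
  exponent \<open>-13/12\<close>. At most \<open>k\<close> elements exceed \<open>k\<close>, and
  together they contribute at most \<open>k powr (1/12)\<close>.\<close>

lemma sum_powr_small_set_le:
  fixes J :: "nat set"
  assumes "finite J" "0 \<notin> J" "card J \<le> k"
  shows "(\<Sum>j\<in>J. real j powr (-11/12)) \<le> ((\<Sum>j=1..k. real j powr (-13/12)) + 1) * real k powr (1/6)"
proof (cases "k = 0")
  case True
  then show ?thesis using assms by simp
next
  case k: False
  have "(\<Sum>j\<in>J. real j powr (-11/12)) = (\<Sum>j | j \<in> J \<and> j \<le> k. real j powr (-11/12)) + (\<Sum>j | j \<in> J \<and> \<not> j \<le> k. real j powr (-11/12))"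
  proof -
    have "{j \<in> J. j \<le> k} \<union> {j \<in> J. \<not> j \<le> k} = J" by auto
    then have "(\<Sum>j\<in>J. real j powr (-11/12)) = (\<Sum>j\<in>{j \<in> J. j \<le> k} \<union> {j \<in> J. \<not> j \<le> k}. real j powr (-11/12))"
      by (simp only:)
    also have "\<dots> = (\<Sum>j | j \<in> J \<and> j \<le> k. real j powr (-11/12)) + (\<Sum>j | j \<in> J \<and> \<not> j \<le> k. real j powr (-11/12))"
      using assms(1) by (intro sum.union_disjoint) auto
    finally show ?thesis .
  qed
  also have "(\<Sum>j | j \<in> J \<and> j \<le> k. real j powr (-11/12)) \<le> (\<Sum>j=1..k. real j powr (-13/12) * real k powr (1/6))"
  proof -
    have "(\<Sum>j | j \<in> J \<and> j \<le> k. real j powr (-11/12)) \<le> (\<Sum>j=1..k. real j powr (-11/12))"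
      using assms(2) by (intro sum_mono2) (auto simp: Suc_le_eq intro!: Nat.gr0I)
    also have "\<dots> \<le> (\<Sum>j=1..k. real j powr (-13/12) * real k powr (1/6))"
    proof (rule sum_mono)
      fix j assume j: "j \<in> {1..k}"
      have "real j powr (-11/12) = real j powr (-13/12) * real j powr (1/6)"
        using j by (simp add: powr_add[symmetric])
      also have "\<dots> \<le> real j powr (-13/12) * real k powr (1/6)"
        using j by (intro mult_left_mono powr_mono2) auto
      finally show "real j powr (-11/12) \<le> real j powr (-13/12) * real k powr (1/6)" .
    qed
    finally show ?thesis .
  qed
  also have "(\<Sum>j | j \<in> J \<and> \<not> j \<le> k. real j powr (-11/12)) \<le> real k powr (1/6)"
  proof -
    have "(\<Sum>j | j \<in> J \<and> \<not> j \<le> k. real j powr (-11/12)) \<le> real (card {j. j \<in> J \<and> \<not> j \<le> k}) * real k powr (-11/12)"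
      using k by (intro sum_bounded_above powr_mono2') auto
    also have "\<dots> \<le> real k * real k powr (-11/12)"
      using assms card_mono[of J "{j. j \<in> J \<and> \<not> j \<le> k}"] by (intro mult_right_mono) auto
    also have "\<dots> = real k powr (1/12)" using k by (simp add: powr_mult_base)
    also have "\<dots> \<le> real k powr (1/6)" using k by (intro powr_mono) auto
    finally show ?thesis .
  qed
  finally show ?thesis unfolding sum_distrib_right[symmetric] by (simp add: algebra_simps)
qed

text \<open>The order divides \<open>q - 1\<close>, so \<open>q = j * k + 1\<close> with distinct
  positive \<open>j\<close>, at most \<open>k\<close> of them. Combining exponents,
  \<open>1/6 - 11/12 = -3/4\<close>.\<close>

lemma sum_primes_of_order_le:
  fixes S :: "nat set"
  assumes "k > 0" "finite S" "\<And>q. q \<in> S \<Longrightarrow> prime q \<and> odd q \<and> ord q 2 = k"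
  shows "(\<Sum>q\<in>S. real q powr (-11/12)) \<le> ((\<Sum>j=1..k. real j powr (-13/12)) + 1) * real k powr (-3/4)"
proof -
  define f where "f = (\<lambda>q. (q - 1) div k)"
  have q: "q = f q * k + 1" "q > 1" if "q \<in> S" for q
  proof -
    have p: "prime q" "odd q" "ord q 2 = k" using assms(3)[OF that] by auto
    have "coprime q 2" using p by simp
    then have "k dvd totient q" using order_divides_totient[of q 2] p by simp
    then have "k dvd q - 1" using p by (simp add: totient_prime)
    then show "q > 1" "q = f q * k + 1" using p prime_gt_1_nat[of q] by (auto simp: f_def)
  qed
  have inj: "inj_on f S" by (rule inj_onI) (metis q(1))
  have "(\<Sum>q\<in>S. real q powr (-11/12)) \<le> (\<Sum>q\<in>S. real (f q) powr (-11/12) * real k powr (-11/12))"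
  proof (rule sum_mono)
    fix q assume "q \<in> S"
    have "f q \<noteq> 0" using q[OF \<open>q \<in> S\<close>] by (metis One_nat_def add_0 mult_0 nat_neq_iff)
    have "f q * k \<le> q" using q(1)[OF \<open>q \<in> S\<close>] by linarith
    then have "real (f q * k) \<le> real q" by (simp only: of_nat_le_iff)
    then have "real q powr (-11/12) \<le> real (f q * k) powr (-11/12)"
      using \<open>f q \<noteq> 0\<close> assms(1) by (intro powr_mono2') auto
    then show "real q powr (-11/12) \<le> real (f q) powr (-11/12) * real k powr (-11/12)"
      by (simp add: powr_mult)
  qed
  also have "\<dots> = (\<Sum>j\<in>f ` S. real j powr (-11/12)) * real k powr (-11/12)"
    using inj by (simp add: sum.reindex sum_distrib_right)
  also have "(\<Sum>j\<in>f ` S. real j powr (-11/12)) \<le> ((\<Sum>j=1..k. real j powr (-13/12)) + 1) * real k powr (1/6)"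
  proof (rule sum_powr_small_set_le)
    show "0 \<notin> f ` S" using q by (metis add_0 image_iff mult_0 nat_neq_iff)
    show "card (f ` S) \<le> k"
      using card_image_le[OF assms(2), of f] card_primes_of_order_le[of k S] assms by fastforce
  qed (use assms in auto)
  finally have "(\<Sum>q\<in>S. real q powr (-11/12))
     \<le> ((\<Sum>j=1..k. real j powr (-13/12)) + 1) * (real k powr (1/6) * real k powr (-11/12))"
    by (simp add: mult_right_mono mult_ac)
  also have "real k powr (1/6) * real k powr (-11/12) = real k powr (-3/4)"
    by (simp add: powr_add[symmetric])
  finally show ?thesis .
qed

text \<open>Writing \<open>k = a * b\<close> turns the left side into a sum over pairs with
  \<open>a * b \<le> Y\<close>, a part of the expanded square.\<close>

lemma sum_divisor_count_powr_le:
  "(\<Sum>k=1..Y. real (card {g. g dvd k}) * real k powr s) \<le> (\<Sum>k=1..Y. real k powr s)\<^sup>2"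
proof -
  define j where "j = (\<lambda>(k::nat, g). (g, k div g))"
  define f where "f = (\<lambda>(a, b). real a powr s * real b powr s)"
  let ?A = "SIGMA k:{1..Y}. {g. g dvd k}"
  have "(\<Sum>k=1..Y. real (card {g. g dvd k}) * real k powr s) = (\<Sum>k=1..Y. \<Sum>g | g dvd k. real k powr s)"
    by simp
  also have "\<dots> = (\<Sum>(k, g)\<in>?A. real k powr s)" by (intro sum.Sigma) auto
  also have "\<dots> = (\<Sum>x\<in>?A. f (j x))"
  proof (rule sum.cong[OF refl], clarify)
    fix k g assume "k \<in> {1..Y}" "g dvd k"
    then have "real k = real g * real (k div g)" by (simp flip: of_nat_mult)
    then have "real k powr s = (real g * real (k div g)) powr s" by (rule arg_cong)
    then show "real k powr s = f (j (k, g))" unfolding f_def j_def by (simp only: powr_mult prod.case)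
  qed
  also have "\<dots> = (\<Sum>x\<in>j ` ?A. f x)"
  proof -
    have "inj_on j ?A" by (rule inj_onI) (auto simp: j_def)
    then show ?thesis by (simp add: sum.reindex)
  qed
  also have "\<dots> \<le> (\<Sum>x\<in>{1..Y} \<times> {1..Y}. f x)"
  proof (rule sum_mono2)
    show "j ` ?A \<subseteq> {1..Y} \<times> {1..Y}"
    proof (rule image_subsetI, clarify)
      fix k g assume k: "k \<in> {1..Y}" "g dvd k"
      then have "g > 0" "g \<le> k" "k div g > 0" by (auto intro!: Nat.gr0I dest: dvd_imp_le simp: dvd_div_eq_0_iff)
      moreover have "k div g \<le> Y" using k by (meson atLeastAtMost_iff div_le_dividend order_trans)
      ultimately show "j (k, g) \<in> {1..Y} \<times> {1..Y}" using k by (auto simp: j_def)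
    qed
  qed (auto simp: f_def)
  also have "\<dots> = (\<Sum>k=1..Y. real k powr s)\<^sup>2"
    by (simp add: f_def power2_eq_square sum_product sum.cartesian_product)
  finally show ?thesis .
qed

text \<open>Group the primes by the order \<open>k\<close>. A group has weight
  \<open>O(k powr (-3/4))\<close>, and \<open>3/4 + 1/3 = 13/12\<close>, so the sum is dominated by
  that of \<open>d(k) * k powr (-13/12)\<close>, at most the square of a convergent zeta
  series.\<close>

lemma sum_primes_order_weight_bounded:
  obtains Z where "\<And>Y. (\<Sum>q | prime q \<and> odd q \<and> q \<le> Y.
     real q powr (-11/12) * (real (card {g. g dvd ord q 2}) * real (ord q 2) powr (-1/3))) \<le> Z"
proof -
  define z where "z = (\<Sum>j. real j powr (-13/12))"
  have sm: "summable (\<lambda>j. real j powr (-13/12))" by (simp add: summable_real_powr_iff)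
  have z: "(\<Sum>j=1..k. real j powr (-13/12)) \<le> z" for k
    unfolding z_def using sm by (intro sum_le_suminf) auto
  have z0: "z \<ge> 0" using z[of 0] by simp
  have "(\<Sum>q | prime q \<and> odd q \<and> q \<le> Y.
     real q powr (-11/12) * (real (card {g. g dvd ord q 2}) * real (ord q 2) powr (-1/3))) \<le> (z + 1) * z\<^sup>2" for Y
  proof -
    define S where "S = {q::nat. prime q \<and> odd q \<and> q \<le> Y}"
    define t where "t = (\<lambda>k::nat. real (card {g. g dvd k}) * real k powr (-1/3))"
    have finS: "finite S" by (simp add: S_def)
    have t0: "t k \<ge> 0" for k by (simp add: t_def)
    have sub: "(\<lambda>q. ord q 2) ` S \<subseteq> {1..Y}"
    proof (rule image_subsetI)
      fix q assume "q \<in> S"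
      then have q: "prime q" "odd q" "q \<le> Y" by (auto simp: S_def)
      have cop: "coprime q 2" using q by simp
      then have "ord q 2 > 0" by simp
      moreover have "ord q 2 dvd totient q" using cop by (rule order_divides_totient)
      then have "ord q 2 \<le> q - 1" using q prime_gt_1_nat[of q] by (intro dvd_imp_le) (auto simp: totient_prime)
      ultimately show "ord q 2 \<in> {1..Y}" using q by (simp del: ord_gt_0_iff)
    qed
    have "(\<Sum>q\<in>S. real q powr (-11/12) * t (ord q 2))
       = (\<Sum>k=1..Y. \<Sum>q | q \<in> S \<and> ord q 2 = k. real q powr (-11/12) * t (ord q 2))"
      using finS sub by (intro sum.group[symmetric]) auto
    also have "\<dots> \<le> (\<Sum>k=1..Y. (z + 1) * (real (card {g. g dvd k}) * real k powr (-13/12)))"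
    proof (rule sum_mono)
      fix k assume k: "k \<in> {1..Y}"
      have "(\<Sum>q | q \<in> S \<and> ord q 2 = k. real q powr (-11/12) * t (ord q 2))
         = (\<Sum>q | q \<in> S \<and> ord q 2 = k. real q powr (-11/12)) * t k"
        by (simp add: sum_distrib_right)
      also have "\<dots> \<le> (((\<Sum>j=1..k. real j powr (-13/12)) + 1) * real k powr (-3/4)) * t k"
        using k finS t0 by (intro mult_right_mono sum_primes_of_order_le) (auto simp: S_def)
      also have "\<dots> \<le> ((z + 1) * real k powr (-3/4)) * t k"
        using z[of k] t0 by (intro mult_right_mono add_mono) auto
      also have "\<dots> = (z + 1) * (real (card {g. g dvd k}) * (real k powr (-3/4) * real k powr (-1/3)))"
        by (simp add: t_def)
      also have "real k powr (-3/4) * real k powr (-1/3) = real k powr (-13/12)"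
        by (simp add: powr_add[symmetric])
      finally show "(\<Sum>q | q \<in> S \<and> ord q 2 = k. real q powr (-11/12) * t (ord q 2))
         \<le> (z + 1) * (real (card {g. g dvd k}) * real k powr (-13/12))" .
    qed
    also have "\<dots> = (z + 1) * (\<Sum>k=1..Y. real (card {g. g dvd k}) * real k powr (-13/12))"
      by (simp add: sum_distrib_left)
    also have "\<dots> \<le> (z + 1) * (\<Sum>k=1..Y. real k powr (-13/12))\<^sup>2"
      using z0 by (intro mult_left_mono sum_divisor_count_powr_le) auto
    also have "\<dots> \<le> (z + 1) * z\<^sup>2" using z z0 by (intro mult_left_mono power_mono sum_nonneg) auto
    finally show ?thesis by (simp add: S_def t_def)
  qed
  then show ?thesis by (rule that)
qed

section \<open>Differences of sums of powers\<close>

text \<open>Strict order lets the sum determine the pair; a lower bound may restrict itself to such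
  representations.\<close>

definition exp_pairs :: "nat \<Rightarrow> (nat \<times> nat) set" where
  "exp_pairs M = {(a, b). 1 \<le> a \<and> a < b \<and> b \<le> M}"

definition square_pow_sum :: "nat \<times> nat \<Rightarrow> nat" where
  "square_pow_sum = (\<lambda>(a, b). 2 ^ a\<^sup>2 + 2 ^ b\<^sup>2)"

lemma exp_pairs_subset: "exp_pairs M \<subseteq> {1..M} \<times> {1..M}"
  by (auto simp: exp_pairs_def)

lemma finite_exp_pairs [simp]: "finite (exp_pairs M)"
  using exp_pairs_subset by (rule finite_subset) simp

lemma card_exp_pairs_le: "card (exp_pairs M) \<le> M\<^sup>2"
  using card_mono[OF _ exp_pairs_subset[of M]] by (simp add: power2_eq_square)

text \<open>The square grid is covered by the pairs, their mirror images and the diagonal.\<close>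

lemma card_exp_pairs_ge: "M\<^sup>2 \<le> 2 * card (exp_pairs M) + M"
proof -
  let ?D = "(\<lambda>a. (a, a)) ` {1..M}"
  have "{1..M} \<times> {1..M} \<subseteq> (exp_pairs M \<union> prod.swap ` exp_pairs M) \<union> ?D"
  proof clarify
    fix a b assume ab: "a \<in> {1..M}" "b \<in> {1..M}" "(a, b) \<notin> ?D" "(a, b) \<notin> prod.swap ` exp_pairs M"
    then have "a \<noteq> b" "(b, a) \<notin> exp_pairs M" by force+
    then show "(a, b) \<in> exp_pairs M" using ab(1,2) by (auto simp: exp_pairs_def)
  qed
  then have "card ({1..M} \<times> {1..M}) \<le> card ((exp_pairs M \<union> prod.swap ` exp_pairs M) \<union> ?D)"
    by (intro card_mono) auto
  also have "\<dots> \<le> card (exp_pairs M) + card (prod.swap ` exp_pairs M) + card ?D"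
    by (meson add_le_mono1 card_Un_le le_trans)
  also have "\<dots> \<le> card (exp_pairs M) + card (exp_pairs M) + card {1..M}"
    by (intro add_mono card_image_le) auto
  finally show ?thesis by (simp add: power2_eq_square)
qed

lemma square_pow_sum_bounds:
  assumes "a < b"
  shows "2 ^ b\<^sup>2 < square_pow_sum (a, b)" "square_pow_sum (a, b) < 2 * 2 ^ b\<^sup>2"
proof -
  have "a\<^sup>2 < b\<^sup>2" using assms by (simp add: power_strict_mono)
  then have "(2::nat) ^ a\<^sup>2 < 2 ^ b\<^sup>2" by simp
  then show "2 ^ b\<^sup>2 < square_pow_sum (a, b)" "square_pow_sum (a, b) < 2 * 2 ^ b\<^sup>2"
    by (auto simp: square_pow_sum_def)
qed

lemma square_pow_sum_le:
  assumes "x \<in> exp_pairs M"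
  shows "square_pow_sum x \<le> 2 * 2 ^ M\<^sup>2"
proof -
  obtain a b where x: "x = (a, b)" by (cases x)
  then have ab: "a < b" "b \<le> M" using assms by (auto simp: exp_pairs_def)
  have "square_pow_sum x < 2 * 2 ^ b\<^sup>2" unfolding x using ab(1) by (rule square_pow_sum_bounds)
  also have "\<dots> \<le> 2 * 2 ^ M\<^sup>2" using ab by (intro mult_left_mono power_increasing power_mono) auto
  finally show ?thesis by simp
qed

text \<open>The sum lies strictly between \<open>2 ^ b\<^sup>2\<close> and twice that, so its size
  reveals \<open>b\<close>, and then \<open>a\<close> follows.\<close>

lemma inj_on_square_pow_sum: "inj_on square_pow_sum (exp_pairs M)"
proof -
  have less: "square_pow_sum (a, b) < square_pow_sum (c, d)" if "a < b" "c < d" "b < d" for a b c d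
  proof -
    have "Suc (b\<^sup>2) \<le> d\<^sup>2" using that(3) by (simp add: Suc_le_eq power_strict_mono)
    then have "(2::nat) ^ Suc (b\<^sup>2) \<le> 2 ^ d\<^sup>2" by (intro power_increasing) auto
    then show ?thesis using square_pow_sum_bounds(2)[OF that(1)] square_pow_sum_bounds(1)[OF that(2)] by simp
  qed
  show ?thesis
  proof (rule inj_onI, clarify)
    fix a b c d assume *: "(a, b) \<in> exp_pairs M" "(c, d) \<in> exp_pairs M"
      "square_pow_sum (a, b) = square_pow_sum (c, d)"
    then have lt: "a < b" "c < d" by (auto simp: exp_pairs_def)
    have "b = d" using less[of a b c d] less[of c d a b] lt * by (metis less_irrefl linorder_neqE_nat)
    then have "(2::nat) ^ a\<^sup>2 = 2 ^ c\<^sup>2" using * by (simp add: square_pow_sum_def)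
    then show "a = c \<and> b = d" using \<open>b = d\<close> by simp
  qed
qed

text \<open>Keeping one orientation makes the subtraction in \<open>pair_diff\<close> exact and
  positive; the other orientation is symmetric.\<close>

definition descending_pairs :: "nat \<Rightarrow> ((nat \<times> nat) \<times> (nat \<times> nat)) set" where
  "descending_pairs M = {(x, y) \<in> exp_pairs M \<times> exp_pairs M. square_pow_sum y < square_pow_sum x}"

definition pair_diff :: "(nat \<times> nat) \<times> (nat \<times> nat) \<Rightarrow> nat" where
  "pair_diff = (\<lambda>(x, y). square_pow_sum x - square_pow_sum y)"

lemma finite_descending_pairs [simp]: "finite (descending_pairs M)"
  by (rule finite_subset[of _ "exp_pairs M \<times> exp_pairs M"]) (auto simp: descending_pairs_def)

lemma card_descending_pairs_le: "card (descending_pairs M) \<le> M ^ 4"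
proof -
  have "card (descending_pairs M) \<le> card (exp_pairs M \<times> exp_pairs M)"
    by (rule card_mono) (auto simp: descending_pairs_def)
  also have "\<dots> \<le> M\<^sup>2 * M\<^sup>2" unfolding card_cartesian_product by (intro mult_le_mono card_exp_pairs_le)
  finally show ?thesis by (simp add: power_numeral_reduce)
qed

lemma pair_diff_bounds:
  assumes "z \<in> descending_pairs M"
  shows "0 < pair_diff z" "pair_diff z \<le> 2 * 2 ^ M\<^sup>2"
proof -
  obtain x y where z: "z = (x, y)" by (cases z)
  show "0 < pair_diff z" "pair_diff z \<le> 2 * 2 ^ M\<^sup>2"
    using assms square_pow_sum_le[of x M] by (auto simp: z descending_pairs_def pair_diff_def)
qed

text \<open>Once the first three exponents are fixed, in at most \<open>M ^ 3\<close> ways,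
  divisibility by \<open>q\<close> fixes \<open>2 ^ d\<^sup>2\<close> modulo \<open>q\<close>, hence
  \<open>d\<^sup>2\<close> modulo the order of \<open>2\<close>. The bound for square classes then
  applies.\<close>

lemma card_pairs_divisible_le:
  assumes "prime q" "odd q"
  shows "real (card {z \<in> descending_pairs M. q dvd pair_diff z})
    \<le> real M ^ 3 * (real (card {g. g dvd ord q 2}) * (real M / sqrt (real (ord q 2)) + 1))"
proof -
  define e where "e = ord q 2"
  define b where "b = real (card {g. g dvd e}) * (real M / sqrt (real e) + 1)"
  define X where "X = {z \<in> descending_pairs M. q dvd pair_diff z}"
  define B where "B = (\<lambda>(a, b, c). {d::nat. d \<le> M \<and> [square_pow_sum (a, b) = square_pow_sum (c, d)] (mod q)})"
  define A where "A = {1..M} \<times> {1..M} \<times> {1..M}"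
  define f :: "(nat \<times> nat) \<times> (nat \<times> nat) \<Rightarrow> (nat \<times> nat \<times> nat) \<times> nat"
    where "f = (\<lambda>((a, b), (c, d)). ((a, b, c), d))"
  have cop: "coprime q 2" using assms by simp
  then have e0: "e > 0" by (simp add: e_def)
  have b0: "b \<ge> 0" by (simp add: b_def)
  have finB: "finite (B t)" for t by (cases t) (auto simp: B_def)
  have cardB: "real (card (B t)) \<le> b" for t
  proof (cases "B t = {}")
    case False
    obtain a1 a2 a3 where t: "t = (a1, a2, a3)" by (cases t)
    obtain d0 where d0: "d0 \<in> B t" using False by auto
    have "B t \<subseteq> {m. m \<le> M \<and> m\<^sup>2 mod e = d0\<^sup>2 mod e}"
    proof
      fix d assume d: "d \<in> B t"
      have "[square_pow_sum (a3, d) = square_pow_sum (a3, d0)] (mod q)"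
        using d d0 unfolding B_def t by (auto intro: cong_trans cong_sym)
      then have "[2 ^ d\<^sup>2 = 2 ^ d0\<^sup>2] (mod q)"
        unfolding square_pow_sum_def by (simp add: cong_add_lcancel_nat)
      then have "[d\<^sup>2 = d0\<^sup>2] (mod e)" unfolding e_def using order_divides_expdiff[OF cop] by blast
      then show "d \<in> {m. m \<le> M \<and> m\<^sup>2 mod e = d0\<^sup>2 mod e}"
        using d by (auto simp: B_def t unique_euclidean_semiring_class.cong_def)
    qed
    then have "card (B t) \<le> card {m. m \<le> M \<and> m\<^sup>2 mod e = d0\<^sup>2 mod e}" by (intro card_mono) auto
    also have "real \<dots> \<le> b" unfolding b_def using e0 by (rule card_square_class_le)
    finally show ?thesis by simp
  qed (use b0 in simp)
  have "inj_on f X" by (rule inj_onI) (auto simp: f_def)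
  moreover have "f ` X \<subseteq> Sigma A B"
  proof (rule image_subsetI)
    fix z assume z: "z \<in> X"
    obtain a b c d where zd: "z = ((a, b), (c, d))" by (metis surj_pair)
    have "[square_pow_sum (a, b) = square_pow_sum (c, d)] (mod q)"
      using z by (auto simp: zd X_def descending_pairs_def pair_diff_def cong_altdef_nat)
    then show "f z \<in> Sigma A B"
      using z by (auto simp: zd X_def descending_pairs_def exp_pairs_def f_def A_def B_def)
  qed
  ultimately have "card X \<le> card (Sigma A B)"
    using finB by (intro card_inj_on_le) (auto simp: A_def)
  also have "\<dots> = (\<Sum>t\<in>A. card (B t))" using finB by (subst card_SigmaI) (auto simp: A_def)
  finally have "real (card X) \<le> (\<Sum>t\<in>A. real (card (B t)))" by (simp flip: of_nat_sum)
  also have "\<dots> \<le> real (card A) * b" using cardB by (intro sum_bounded_above) auto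
  also have "real (card A) = real M ^ 3" by (simp add: A_def power_numeral_reduce)
  finally show ?thesis by (simp add: X_def b_def e_def)
qed

text \<open>The prime \<open>2\<close> and the primes above \<open>M ^ 3\<close> contribute at most
  \<open>3\<close> to each difference. For the odd primes up to \<open>M ^ 3\<close> the sums are
  exchanged and the divisible differences counted.\<close>

lemma sum_prime_factors_pair_diff_le:
  obtains C where "C > 0" "\<And>M. M \<ge> 1 \<Longrightarrow>
    (\<Sum>z\<in>descending_pairs M. \<Sum>q\<in>prime_factors (pair_diff z). real q powr (-11/12)) \<le> C * real M ^ 4"
proof -
  obtain Z where Z: "\<And>Y. (\<Sum>q | prime q \<and> odd q \<and> q \<le> Y.
     real q powr (-11/12) * (real (card {g. g dvd ord q 2}) * real (ord q 2) powr (-1/3))) \<le> Z"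
    using sum_primes_order_weight_bounded by blast
  have Z0: "Z \<ge> 0" using Z[of 0] by (auto intro: order_trans[OF sum_nonneg])
  have "(\<Sum>z\<in>descending_pairs M. \<Sum>q\<in>prime_factors (pair_diff z). real q powr (-11/12)) \<le> (3 + 2 * Z) * real M ^ 4"
    if M: "M \<ge> 1" for M
  proof -
    define u where "u = (\<lambda>q::nat. real q powr (-11/12))"
    define S where "S = {q. prime q \<and> odd q \<and> q \<le> M ^ 3}"
    define W where "W = descending_pairs M"
    have finS: "finite S" by (simp add: S_def)
    have u0: "u q \<ge> 0" for q by (simp add: u_def)
    have cube: "real M ^ 3 = real M powr 3" using M by simp
    have pointwise: "(\<Sum>q\<in>prime_factors (pair_diff z). u q) \<le> 3 + (\<Sum>q\<in>S. if q dvd pair_diff z then u q else 0)"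
      if z: "z \<in> W" for z
    proof -
      define h where "h = pair_diff z"
      have h: "0 < h" "h \<le> 2 * 2 ^ M\<^sup>2" using pair_diff_bounds[of z M] z by (auto simp: h_def W_def)
      have "(\<Sum>q\<in>prime_factors h. u q) \<le> (\<Sum>q\<in>prime_factors h. (if q = 2 then 1 else 0)
         + ((if q > M ^ 3 then real M powr (-2) else 0) + (if q \<in> S then u q else 0)))"
      proof (rule sum_mono)
        fix q assume q: "q \<in> prime_factors h"
        then have "prime q" by auto
        then have "q \<ge> 2" by (rule prime_ge_2_nat)
        consider "q \<in> S" | "q = 2" "q \<notin> S" | "q > M ^ 3" "q \<noteq> 2" "q \<notin> S"
          using \<open>prime q\<close> prime_odd_nat[of q] \<open>q \<ge> 2\<close> by (force simp: S_def)
        then show "u q \<le> (if q = 2 then 1 else 0)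
         + ((if q > M ^ 3 then real M powr (-2) else 0) + (if q \<in> S then u q else 0))"
        proof cases
          case 2
          have "u q \<le> real 1 powr (-11/12)" unfolding u_def using \<open>q \<ge> 2\<close> by (intro powr_mono2') auto
          then show ?thesis using 2 by (simp add: add_increasing2)
        next
          case 3
          \<comment> \<open>Beyond \<open>M ^ 3\<close> each weight is at most
            \<open>M powr (-11/4)\<close>, hence at most \<open>M powr (-2)\<close>; this offsets
            the at most \<open>2 * M\<^sup>2\<close> prime factors of \<open>h\<close>.\<close>
          have "real (M ^ 3) \<le> real q" using 3 by (simp only: of_nat_le_iff less_imp_le)
          then have "u q \<le> (real M ^ 3) powr (-11/12)" unfolding u_def using M by (intro powr_mono2') auto
          also have "\<dots> = real M powr (3 * (-11/12))" by (simp only: cube powr_powr)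
          also have "\<dots> \<le> real M powr (-2)" using M by (intro powr_mono) auto
          finally show ?thesis using 3 by simp
        qed simp
      qed
      also have "\<dots> = (\<Sum>q\<in>prime_factors h. if q = 2 then 1 else 0)
          + ((\<Sum>q\<in>prime_factors h. if q > M ^ 3 then real M powr (-2) else 0)
          + (\<Sum>q\<in>prime_factors h. if q \<in> S then u q else 0))"
        by (simp only: sum.distrib)
      also have "(\<Sum>q\<in>prime_factors h. if q = 2 then 1 else 0) \<le> (1::real)" by simp
      also have "(\<Sum>q\<in>prime_factors h. if q > M ^ 3 then real M powr (-2) else 0) \<le> 2"
      proof -
        have "(\<Sum>q\<in>prime_factors h. if q > M ^ 3 then real M powr (-2) else 0) \<le> real (card (prime_factors h)) * real M powr (-2)"
          by (rule sum_bounded_above) auto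
        also have "real (card (prime_factors h)) \<le> 2 * (real M)\<^sup>2"
        proof -
          have "2 ^ card (prime_factors h) \<le> h"
            using h by (intro power_card_primes_le) (auto intro: prime_ge_2_nat in_prime_factors_imp_prime)
          also have "\<dots> \<le> 2 ^ Suc (M\<^sup>2)" using h by simp
          finally have "card (prime_factors h) \<le> Suc (M\<^sup>2)" by (rule power_le_imp_le_exp[rotated]) simp
          also have "\<dots> \<le> 2 * M\<^sup>2" using M by simp
          finally have "real (card (prime_factors h)) \<le> real (2 * M\<^sup>2)" by (simp only: of_nat_le_iff)
          then show ?thesis by simp
        qed
        also have "2 * (real M)\<^sup>2 * real M powr (-2) = 2" using M by (simp add: powr_minus powr_numeral)
        finally show ?thesis by (simp add: mult_right_mono)
      qed
      also have "(\<Sum>q\<in>prime_factors h. if q \<in> S then u q else 0) = (\<Sum>q\<in>S. if q dvd h then u q else 0)"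
      proof -
        have "(\<Sum>q\<in>prime_factors h. if q \<in> S then u q else 0) = (\<Sum>q | q \<in> prime_factors h \<and> q \<in> S. u q)"
          by (simp add: sum.inter_filter)
        also have "{q. q \<in> prime_factors h \<and> q \<in> S} = {q. q \<in> S \<and> q dvd h}"
          using h by (auto simp: S_def prime_factors_dvd)
        also have "(\<Sum>q | q \<in> S \<and> q dvd h. u q) = (\<Sum>q\<in>S. if q dvd h then u q else 0)"
          using finS by (simp add: sum.inter_filter)
        finally show ?thesis .
      qed
      finally show ?thesis by (simp add: h_def)
    qed
    have "(\<Sum>z\<in>W. \<Sum>q\<in>prime_factors (pair_diff z). u q) \<le> (\<Sum>z\<in>W. 3 + (\<Sum>q\<in>S. if q dvd pair_diff z then u q else 0))"
      by (intro sum_mono pointwise)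
    also have "\<dots> = 3 * real (card W) + (\<Sum>q\<in>S. \<Sum>z\<in>W. if q dvd pair_diff z then u q else 0)"
      unfolding sum.distrib by (subst sum.swap) simp
    also have "(\<Sum>q\<in>S. \<Sum>z\<in>W. if q dvd pair_diff z then u q else 0)
       = (\<Sum>q\<in>S. u q * real (card {z \<in> W. q dvd pair_diff z}))"
      by (simp add: sum.inter_filter[symmetric] W_def mult.commute)
    also have "\<dots> \<le> (\<Sum>q\<in>S. 2 * real M ^ 4 * (u q * (real (card {g. g dvd ord q 2}) * real (ord q 2) powr (-1/3))))"
    proof (rule sum_mono)
      fix q assume "q \<in> S"
      then have q: "prime q" "odd q" "q \<le> M ^ 3" by (auto simp: S_def)
      define e where "e = ord q 2"
      have cop: "coprime q 2" using q by simp
      then have e0: "e > 0" by (simp add: e_def)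
      have "e dvd totient q" unfolding e_def using cop by (rule order_divides_totient)
      then have "e \<le> q - 1" using q prime_gt_1_nat[of q] by (intro dvd_imp_le) (auto simp: totient_prime)
      then have "e \<le> M ^ 3" using q by linarith
      then have eM: "real e \<le> real M ^ 3" by (metis of_nat_le_iff of_nat_power)
      \<comment> \<open>The cutoff \<open>q \<le> M ^ 3\<close> is used here: it gives
        \<open>e \<le> M ^ 3\<close>, so the summand \<open>1\<close> is also at most
        \<open>M * e powr (-1/3)\<close>.\<close>
      have "real M / sqrt (real e) + 1 \<le> 2 * (real M * real e powr (-1/3))"
      proof -
        have "1 / sqrt (real e) = real e powr (-1/2)"
          using e0 by (simp add: powr_half_sqrt[symmetric] powr_minus_divide)
        also have "\<dots> \<le> real e powr (-1/3)" using e0 by (intro powr_mono) auto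
        finally have "real M * (1 / sqrt (real e)) \<le> real M * real e powr (-1/3)" by (intro mult_left_mono) auto
        moreover have "1 \<le> real M * real e powr (-1/3)"
        proof -
          have "1 = real M * (real M ^ 3) powr (-1/3)"
            unfolding cube powr_powr using M by (simp add: powr_minus)
          also have "\<dots> \<le> real M * real e powr (-1/3)"
            using eM e0 by (intro mult_left_mono powr_mono2') auto
          finally show ?thesis .
        qed
        ultimately show ?thesis by simp
      qed
      then have "real (card {z \<in> W. q dvd pair_diff z})
          \<le> real M ^ 3 * (real (card {g. g dvd e}) * (2 * (real M * real e powr (-1/3))))"
        unfolding W_def e_def
        by (intro order_trans[OF card_pairs_divisible_le[OF q(1,2)]] mult_left_mono) auto
      also have "\<dots> = 2 * real M ^ 4 * (real (card {g. g dvd e}) * real e powr (-1/3))"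
        by (simp add: power_numeral_reduce)
      finally have "u q * real (card {z \<in> W. q dvd pair_diff z})
         \<le> u q * (2 * real M ^ 4 * (real (card {g. g dvd e}) * real e powr (-1/3)))"
        using u0 by (intro mult_left_mono) auto
      then show "u q * real (card {z \<in> W. q dvd pair_diff z})
         \<le> 2 * real M ^ 4 * (u q * (real (card {g. g dvd ord q 2}) * real (ord q 2) powr (-1/3)))"
        by (simp only: e_def mult_ac)
    qed
    also have "\<dots> = 2 * real M ^ 4 * (\<Sum>q\<in>S. u q * (real (card {g. g dvd ord q 2}) * real (ord q 2) powr (-1/3)))"
      by (rule sum_distrib_left[symmetric])
    also have "\<dots> \<le> 2 * real M ^ 4 * Z" unfolding S_def u_def by (intro mult_left_mono Z) auto
    also have "3 * real (card W) \<le> 3 * real M ^ 4"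
      using card_descending_pairs_le[of M] unfolding W_def by (metis mult_left_mono of_nat_le_iff of_nat_power zero_le_numeral)
    finally show ?thesis by (simp add: u_def W_def algebra_simps)
  qed
  then show ?thesis using Z0 by (intro that[of "3 + 2 * Z"]) auto
qed

section \<open>Coincidences and the second moment\<close>

text \<open>Cauchy-Schwarz for the representation numbers \<open>r n\<close>: their sum is
  \<open>card A\<close>, and the sum of their squares counts the collisions.\<close>

lemma card_image_collisions:
  assumes "finite A"
  shows "(real (card A))\<^sup>2 \<le> real (card (f ` A)) * real (card {(u, v) \<in> A \<times> A. f u = f v})"
proof -
  define r where "r = (\<lambda>n. card {u \<in> A. f u = n})"
  have "card A = (\<Sum>n\<in>f ` A. r n)"
    using sum.group[OF assms, of "f ` A" f "\<lambda>_. 1::nat"] assms by (simp add: r_def)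
  then have "(real (card A))\<^sup>2 = (\<Sum>n\<in>f ` A. real (r n))\<^sup>2" by simp
  also have "\<dots> \<le> (\<Sum>n\<in>f ` A. (real (r n))\<^sup>2) * card (f ` A)" by (rule sum_squared_le_sum_of_squares)
  also have "(\<Sum>n\<in>f ` A. (real (r n))\<^sup>2) = real (card {(u, v) \<in> A \<times> A. f u = f v})"
  proof -
    have "{(u, v) \<in> A \<times> A. f u = f v} = (\<Union>n\<in>f ` A. {u \<in> A. f u = n} \<times> {u \<in> A. f u = n})" by auto
    also have "card \<dots> = (\<Sum>n\<in>f ` A. card ({u \<in> A. f u = n} \<times> {u \<in> A. f u = n}))"
      using assms by (intro card_UN_disjoint) auto
    finally show ?thesis by (simp add: r_def card_cartesian_product power2_eq_square)
  qed
  finally show ?thesis by (simp add: mult.commute)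
qed

text \<open>Equal shifts force equal pairs, by injectivity. Otherwise, up to swapping, a collision
  is an element \<open>p\<close> of \<open>P\<close> for which \<open>p + (s x - s y)\<close> also
  lies in \<open>P\<close>.\<close>

lemma card_collisions_le:
  fixes P :: "nat set" and I :: "'i set" and s :: "'i \<Rightarrow> nat"
  assumes "finite P" "finite I" "inj_on s I"
  defines "W \<equiv> {(x, y) \<in> I \<times> I. s y < s x}"
  shows "card {(u, v) \<in> (P \<times> I) \<times> (P \<times> I). fst u + s (snd u) = fst v + s (snd v)}
     \<le> card (P \<times> I) + 2 * (\<Sum>(x, y)\<in>W. card {p \<in> P. p + (s x - s y) \<in> P})"
proof -
  define Q where "Q = {(u, v) \<in> (P \<times> I) \<times> (P \<times> I). fst u + s (snd u) = fst v + s (snd v)}"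
  define X where "X = (SIGMA z:W. {p \<in> P. p + (s (fst z) - s (snd z)) \<in> P})"
  define f :: "('i \<times> 'i) \<times> nat \<Rightarrow> (nat \<times> 'i) \<times> (nat \<times> 'i)"
    where "f = (\<lambda>((x, y), p). ((p, x), (p + (s x - s y), y)))"
  have finW: "finite W" unfolding W_def by (rule finite_subset[of _ "I \<times> I"]) (use assms in auto)
  have finX: "finite X" unfolding X_def using finW assms(1) by auto
  have "Q \<subseteq> (\<lambda>u. (u, u)) ` (P \<times> I) \<union> (f ` X \<union> prod.swap ` f ` X)"
  proof
    fix z assume "z \<in> Q"
    then obtain p x q y where z: "z = ((p, x), (q, y))"
      and *: "p \<in> P" "q \<in> P" "x \<in> I" "y \<in> I" "p + s x = q + s y" by (auto simp: Q_def)
    consider "s x = s y" | "s y < s x" | "s x < s y" by linarith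
    then show "z \<in> (\<lambda>u. (u, u)) ` (P \<times> I) \<union> (f ` X \<union> prod.swap ` f ` X)"
    proof cases
      case 1
      then have "x = y" using * assms(3) by (auto dest: inj_onD)
      then show ?thesis using * by (auto simp: z)
    next
      case 2
      then have "q = p + (s x - s y)" using * by simp
      then have "((x, y), p) \<in> X" "f ((x, y), p) = ((p, x), (q, y))" using * 2 by (auto simp: X_def W_def f_def)
      then have "z \<in> f ` X" unfolding z by (metis image_eqI)
      then show ?thesis by blast
    next
      case 3
      then have "p = q + (s y - s x)" using * by simp
      then have "((y, x), q) \<in> X" "f ((y, x), q) = ((q, y), (p, x))" using * 3 by (auto simp: X_def W_def f_def)
      then have "z \<in> prod.swap ` f ` X" unfolding z by (metis image_eqI swap_simp)
      then show ?thesis by blast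
    qed
  qed
  then have "card Q \<le> card ((\<lambda>u. (u, u)) ` (P \<times> I) \<union> (f ` X \<union> prod.swap ` f ` X))"
    using finX assms(1,2) by (intro card_mono) auto
  also have "\<dots> \<le> card ((\<lambda>u. (u, u)) ` (P \<times> I)) + (card (f ` X) + card (prod.swap ` f ` X))"
    by (meson add_left_mono card_Un_le le_trans)
  also have "\<dots> \<le> card (P \<times> I) + (card X + card X)"
    using finX assms(1,2) by (intro add_mono card_image_le order_trans[OF card_image_le card_image_le]) auto
  also have "card X = (\<Sum>(x, y)\<in>W. card {p \<in> P. p + (s x - s y) \<in> P})"
    unfolding X_def using finW assms(1) by (subst card_SigmaI) (auto simp: case_prod_unfold)
  finally show ?thesis by (simp add: Q_def)
qed

lemma card_V_lower_bound:
  obtains c where "c > 0"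
    "eventually (\<lambda>N. c * real N \<le> real (card {n \<in> V. 1 \<le> n \<and> n \<le> 2 * N})) at_top"
proof -
  obtain C1 where C1: "C1 > 0" and pairs: "eventually (\<lambda>N. \<forall>h>0. real (card {p. p < N \<and> prime p \<and> prime (p + h)})
       \<le> C1 * (\<Prod>q\<in>prime_factors h. 1 + 1 / real q)\<^sup>2 * real N / (ln (real N))\<^sup>2) at_top"
    by (rule prime_pairs_upper_bound)
  obtain C2 where C2: "C2 > 0" and singular: "\<And>Q. finite Q \<Longrightarrow> (\<And>q. q \<in> Q \<Longrightarrow> prime q) \<Longrightarrow>
    (\<Prod>q\<in>Q. 1 + 1 / real q)\<^sup>2 \<le> C2 * (1 + (\<Sum>q\<in>Q. real q powr (-11/12)))"
    using prod_one_plus_inverse_le by blast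
  obtain C3 where C3: "C3 > 0" and weights: "\<And>M. M \<ge> 1 \<Longrightarrow>
    (\<Sum>z\<in>descending_pairs M. \<Sum>q\<in>prime_factors (pair_diff z). real q powr (-11/12)) \<le> C3 * real M ^ 4"
    using sum_prime_factors_pair_diff_le by blast
  define C where "C = C1 * C2 * (1 + C3)"
  have C0: "C > 0" using C1 C2 C3 by (simp add: C_def)
  \<comment> \<open>There are \<open>B \<ge> N / 32\<close> representations and at most
    \<open>B * (1 + 64 * C)\<close> collisions, so at least \<open>B / (1 + 64 * C)\<close> distinct
    values.\<close>
  define c where "c = 1 / (32 * (1 + 64 * C))"
  have c0: "c > 0" using C0 by (simp add: c_def)
  have "eventually (\<lambda>N::nat. (of_int \<lfloor>sqrt (ln (real N))\<rfloor>) \<ge> (2::real)) at_top" by real_asymp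
  moreover have "eventually (\<lambda>N::nat. (of_int \<lfloor>sqrt (ln (real N))\<rfloor>)\<^sup>2 / 2 - of_int \<lfloor>sqrt (ln (real N))\<rfloor> / 2 \<ge> ln (real N) / 4) at_top"
    by real_asymp
  moreover have "eventually (\<lambda>N::nat. 2 * real N powr (25 / 36) \<le> real N) at_top" by real_asymp
  moreover have "eventually (\<lambda>N::nat. ln (real N) > 0) at_top" by real_asymp
  ultimately have "eventually (\<lambda>N. c * real N \<le> real (card {n \<in> V. 1 \<le> n \<and> n \<le> 2 * N})) at_top"
    using pairs chebyshev_lower_bound eventually_gt_at_top[of 0]
  proof eventually_elim
    case (elim N)
    \<comment> \<open>This size balances two needs: about \<open>ln N\<close> exponent pairs to
      offset the density of primes, and sums of powers not exceeding \<open>N\<close>.\<close>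
    define M where "M = nat \<lfloor>sqrt (ln (real N))\<rfloor>"
    define P where "P = {p. p < N \<and> prime p}"
    define I where "I = exp_pairs M"
    define L where "L = ln (real N)"
    define B where "B = real (card (P \<times> I))"
    define f where "f = (\<lambda>u. fst u + square_pow_sum (snd u))"
    have L0: "L > 0" using elim(4) by (simp add: L_def)
    have N0: "real N > 0" using elim by simp
    have "\<lfloor>sqrt L\<rfloor> \<ge> 0" using L0 by simp
    then have M: "real M = of_int \<lfloor>sqrt L\<rfloor>" unfolding M_def L_def[symmetric] by simp
    then have M2: "M \<ge> 2" using elim(1) unfolding L_def by linarith
    have M_sq: "(real M)\<^sup>2 \<le> L"
    proof -
      have "real M \<le> sqrt L" unfolding M by linarith
      then have "(real M)\<^sup>2 \<le> (sqrt L)\<^sup>2" by (intro power_mono) auto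
      then show ?thesis using L0 by simp
    qed
    have finP: "finite P" by (simp add: P_def)
    have finI: "finite I" by (simp add: I_def)
    \<comment> \<open>\<open>2 ^ M\<^sup>2\<close> is at most \<open>N powr ln 2\<close>, and
      \<open>ln 2 < 1\<close> leaves room for the factor \<open>2\<close>.\<close>
    have small: "square_pow_sum x \<le> N" if "x \<in> I" for x
    proof -
      have "real (square_pow_sum x) \<le> real (2 * 2 ^ M\<^sup>2)"
        using square_pow_sum_le[of x M] that unfolding I_def of_nat_le_iff by simp
      also have "\<dots> = 2 * 2 powr ((real M)\<^sup>2)" by (simp add: powr_realpow flip: of_nat_power)
      also have "\<dots> \<le> 2 * 2 powr L" using M_sq by simp
      also have "2 powr L = real N powr ln 2" using N0 by (simp add: powr_def L_def mult.commute)
      also have "\<dots> \<le> real N powr (25 / 36)" using N0 ln2_le_25_over_36 by (intro powr_mono) auto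
      also have "2 * real N powr (25 / 36) \<le> real N" by (rule elim(3))
      finally show ?thesis by simp
    qed
    have sub: "f ` (P \<times> I) \<subseteq> {n \<in> V. 1 \<le> n \<and> n \<le> 2 * N}"
    proof (rule image_subsetI)
      fix u assume "u \<in> P \<times> I"
      then obtain p a b where u: "u = (p, (a, b))" "p \<in> P" "(a, b) \<in> I" by auto
      have "prime p" "p < N" using u by (auto simp: P_def)
      moreover have "1 \<le> a" "1 \<le> b" using u by (auto simp: I_def exp_pairs_def)
      moreover have "f u = p + 2 ^ a\<^sup>2 + 2 ^ b\<^sup>2" by (simp add: f_def u square_pow_sum_def)
      ultimately have "f u \<in> V" unfolding V_def by blast
      moreover have "f u = p + square_pow_sum (a, b)" by (simp add: f_def u)
      ultimately show "f u \<in> {n \<in> V. 1 \<le> n \<and> n \<le> 2 * N}"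
        using small[OF u(3)] prime_ge_1_nat[OF \<open>prime p\<close>] \<open>p < N\<close> by simp
    qed
    have B_ge: "real N / 32 \<le> B"
    proof -
      have "real (M\<^sup>2) \<le> real (2 * card I + M)" unfolding I_def of_nat_le_iff by (rule card_exp_pairs_ge)
      then have "(real M)\<^sup>2 / 2 - real M / 2 \<le> real (card I)" by simp
      then have "L / 4 \<le> real (card I)" using elim(2) unfolding L_def[symmetric] M[symmetric] by linarith
      moreover have "1 / 4 * real N / L \<le> real (card P)" using elim(6) by (simp add: P_def L_def)
      ultimately have "(1 / 4 * real N / L) * (L / 4) \<le> real (card P) * real (card I)"
        using L0 by (intro mult_mono) auto
      then show ?thesis using L0 N0 by (simp add: B_def card_cartesian_product)
    qed
    \<comment> \<open>Each difference costs \<open>O(N / L\<^sup>2)\<close> times its singular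
      factor. That factor is bounded on average, and the at most
      \<open>M ^ 4 \<le> L\<^sup>2\<close> differences cancel the logarithms.\<close>
    have "real (\<Sum>(x, y)\<in>descending_pairs M. card {p \<in> P. p + (square_pow_sum x - square_pow_sum y) \<in> P})
        = (\<Sum>z\<in>descending_pairs M. real (card {p \<in> P. p + pair_diff z \<in> P}))"
      by (simp add: pair_diff_def case_prod_unfold)
    also have "\<dots> \<le> (\<Sum>z\<in>descending_pairs M. C1 * C2 * (real N / L\<^sup>2)
        * (1 + (\<Sum>q\<in>prime_factors (pair_diff z). real q powr (-11/12))))"
    proof (rule sum_mono)
      fix z assume z: "z \<in> descending_pairs M"
      define K where "K = (\<Prod>q\<in>prime_factors (pair_diff z). 1 + 1 / real q)\<^sup>2"
      define T where "T = 1 + (\<Sum>q\<in>prime_factors (pair_diff z). real q powr (-11/12))"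
      have "card {p \<in> P. p + pair_diff z \<in> P} \<le> card {p. p < N \<and> prime p \<and> prime (p + pair_diff z)}"
        by (intro card_mono) (auto simp: P_def)
      then have "real (card {p \<in> P. p + pair_diff z \<in> P}) \<le> C1 * K * real N / L\<^sup>2"
        using elim(5) pair_diff_bounds(1)[OF z] unfolding K_def L_def by (meson of_nat_mono order_trans)
      also have "\<dots> = C1 * (real N / L\<^sup>2) * K" by simp
      also have "\<dots> \<le> C1 * (real N / L\<^sup>2) * (C2 * T)"
        unfolding K_def T_def using C1 by (intro mult_left_mono singular) auto
      finally show "real (card {p \<in> P. p + pair_diff z \<in> P})
        \<le> C1 * C2 * (real N / L\<^sup>2) * (1 + (\<Sum>q\<in>prime_factors (pair_diff z). real q powr (-11/12)))"
        by (simp add: T_def mult_ac)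
    qed
    also have "\<dots> = C1 * C2 * (real N / L\<^sup>2) * (real (card (descending_pairs M))
        + (\<Sum>z\<in>descending_pairs M. \<Sum>q\<in>prime_factors (pair_diff z). real q powr (-11/12)))"
      unfolding sum_distrib_left[symmetric] sum.distrib by simp
    also have "\<dots> \<le> C1 * C2 * (real N / L\<^sup>2) * (real M ^ 4 + C3 * real M ^ 4)"
    proof (intro mult_left_mono add_mono weights)
      have "real (card (descending_pairs M)) \<le> real (M ^ 4)" unfolding of_nat_le_iff by (rule card_descending_pairs_le)
      then show "real (card (descending_pairs M)) \<le> real M ^ 4" by simp
    qed (use C1 C2 M2 in auto)
    also have "\<dots> = C * (real N / L\<^sup>2) * real M ^ 4" by (simp add: C_def algebra_simps)
    also have "\<dots> \<le> C * (real N / L\<^sup>2) * L\<^sup>2"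
    proof (intro mult_left_mono)
      have "((real M)\<^sup>2)\<^sup>2 \<le> L\<^sup>2" using M_sq by (intro power_mono) auto
      then show "real M ^ 4 \<le> L\<^sup>2" by simp
    qed (use C0 in auto)
    also have "\<dots> = C * real N" using L0 by simp
    finally have off_diag: "real (\<Sum>(x, y)\<in>descending_pairs M. card {p \<in> P. p + (square_pow_sum x - square_pow_sum y) \<in> P})
      \<le> C * real N" .
    define E where "E = card {(u, v) \<in> (P \<times> I) \<times> (P \<times> I). f u = f v}"
    have "E \<le> card (P \<times> I) + 2 * (\<Sum>(x, y)\<in>descending_pairs M. card {p \<in> P. p + (square_pow_sum x - square_pow_sum y) \<in> P})"
      using card_collisions_le[OF finP finI, of square_pow_sum] inj_on_square_pow_sum[of M]
      unfolding E_def f_def descending_pairs_def I_def by simp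
    then have "real E \<le> B + 2 * real (\<Sum>(x, y)\<in>descending_pairs M. card {p \<in> P. p + (square_pow_sum x - square_pow_sum y) \<in> P})"
      unfolding B_def by linarith
    then have "real E \<le> B + 2 * (C * real N)" using off_diag by linarith
    \<comment> \<open>Replacing \<open>N\<close> by \<open>32 * B\<close> makes the collision bound
      linear in \<open>B\<close>, so one factor \<open>B\<close> cancels in Cauchy-Schwarz.\<close>
    also have "\<dots> \<le> B + 2 * (C * (32 * B))" using B_ge C0 by (intro add_left_mono mult_left_mono) auto
    also have "\<dots> = B * (1 + 64 * C)" by (simp add: algebra_simps)
    finally have E: "real E \<le> B * (1 + 64 * C)" .
    have B0: "B > 0" using B_ge N0 by linarith
    have "B\<^sup>2 \<le> real (card (f ` (P \<times> I))) * real E"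
      unfolding B_def E_def using finP finI by (intro card_image_collisions) auto
    also have "\<dots> \<le> real (card (f ` (P \<times> I))) * (B * (1 + 64 * C))" using E by (intro mult_left_mono) auto
    finally have "B * B \<le> B * (real (card (f ` (P \<times> I))) * (1 + 64 * C))"
      by (simp add: power2_eq_square mult_ac)
    then have "B \<le> real (card (f ` (P \<times> I))) * (1 + 64 * C)" using B0 by simp
    then have "real N / 32 \<le> real (card (f ` (P \<times> I))) * (1 + 64 * C)" using B_ge by linarith
    then have "c * real N \<le> real (card (f ` (P \<times> I)))"
      using C0 by (simp add: c_def field_simps)
    also have "\<dots> \<le> real (card {n \<in> V. 1 \<le> n \<and> n \<le> 2 * N})" using sub by (simp add: card_mono)
    finally show ?case .
  qed
  then show ?thesis using c0 by (intro that[of c]) auto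
qed

theorem theorem1:
  shows "(\<exists>c x\<^sub>0 :: real. c > 0 \<and> (\<forall>x \<ge> x\<^sub>0. real (counting V x) \<ge> c * x)) \<and>
    lower_density V > 0"
proof -
  obtain c where c: "c > 0"
    and ev: "eventually (\<lambda>N. c * real N \<le> real (card {n \<in> V. 1 \<le> n \<and> n \<le> 2 * N})) at_top"
    by (rule card_V_lower_bound)
  obtain N0 where N0: "\<And>N. N \<ge> N0 \<Longrightarrow> c * real N \<le> real (card {n \<in> V. 1 \<le> n \<and> n \<le> 2 * N})"
    using ev unfolding eventually_at_top_linorder by blast
  have bound: "real (counting V x) \<ge> c / 4 * x" if x: "x \<ge> max 4 (2 * real N0 + 2)" for x
  proof -
    \<comment> \<open>The values found reach up to \<open>2 * N\<close>, whence the half of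
      \<open>x\<close>; \<open>x \<ge> 4\<close> gives \<open>N \<ge> x / 4\<close>.\<close>
    define N where "N = nat \<lfloor>x / 2\<rfloor>"
    have N: "real N \<le> x / 2" "real N \<ge> x / 2 - 1" unfolding N_def using x by linarith+
    have "real N \<ge> real N0" using N x by simp
    then have "c * real N \<le> real (card {n \<in> V. 1 \<le> n \<and> n \<le> 2 * N})" by (intro N0) simp
    also have "card {n \<in> V. 1 \<le> n \<and> n \<le> 2 * N} \<le> counting V x"
      unfolding counting_def
    proof (rule card_mono)
      show "finite {n \<in> V. 1 \<le> real n \<and> real n \<le> x}"
        by (rule finite_subset[of _ "{..nat \<lfloor>x\<rfloor>}"]) (auto simp: le_nat_floor)
      show "{n \<in> V. 1 \<le> n \<and> n \<le> 2 * N} \<subseteq> {n \<in> V. 1 \<le> real n \<and> real n \<le> x}"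
        using N(1) by auto
    qed
    finally have "c * real N \<le> real (counting V x)" by simp
    moreover have "c * (x / 4) \<le> c * real N" using c N x by (intro mult_left_mono) auto
    ultimately show ?thesis by simp
  qed
  have "eventually (\<lambda>n. ereal (c / 4) \<le> ereal (real (counting V (real n)) / real n)) at_top"
    using eventually_ge_at_top[of "2 * N0 + 4"]
  proof eventually_elim
    case (elim n)
    have "c / 4 * real n \<le> real (counting V (real n))" using elim by (intro bound) auto
    then show ?case using elim by (simp add: field_simps)
  qed
  then have "ereal (c / 4) \<le> lower_density V" unfolding lower_density_def by (rule Liminf_bounded)
  moreover have "ereal (c / 4) > 0" using c by simp
  ultimately have "lower_density V > 0" by (rule less_le_trans[rotated])
  then show ?thesis using bound c by (intro conjI exI[of _ "c / 4"] exI[of _ "max 4 (2 * real N0 + 2)"]) auto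
qed

end
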